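(* Let $\Omega\subset\mathbb R^d$ be open and let $\mu\in S(\partial\Omega)-S_K(\partial\Omega)$. Then the operator $\Delta_\mu$ is a realization of the Laplacian on $L^2(\Omega)$: for every $u\in D(\Delta_\mu)$ one has $\Delta_\mu u=\Delta u$ in $\mathcal D(\Omega)'$, where $\Delta u$ is the distributional Laplacian of $u$.
   Context: Let $\Omega\subset\mathbb R^d$ be open, $\lambda$ Lebesgue measure, and $m(A)=\lambda(A\cap\Omega)$ for Borel $A\subset\overline\Omega$. Let $\widetilde H^1(\Omega)$ be the closure of $H^1(\Omega)\cap C_c(\overline\Omega)$ in $H^1(\Omega)$. The form $\mathcal E(u,v)=\int_\Omega\nabla u\nabla v\,dx$ with domain $\mathcal F=\widetilde H^1(\Omega)$ is a regular local Dirichlet form on $L^2(\overline\Omega,m)=L^2(\Omega)$; put $\mathcal E_1(u,v)=\mathcal E(u,v)+(u,v)_{L^2(\Omega)}$. The relative capacity of a relatively open $A\subset\overline\Omega$ is $\mathrm{Cap}_{\overline\Omega}(A)=\inf\{\mathcal E_1(u,u):u\in\widetilde H^1(\Omega),\ u\ge 1\text{ a.e. on }A\}$, and for arbitrary $A\subset\overline\Omega$, $\mathrm{Cap}_{\overline\Omega}(A)=\inf\{\mathrm{Cap}_{\overline\Omega}(B):B\text{ relatively open},\ A\subset B\subset\overline\Omega\}$. A function $u:\overline\Omega\to\mathbb R$ is relatively quasi-continuous if for every $\epsilon>0$ there is a relatively open $G\subset\overline\Omega$ with $\mathrm{Cap}_{\overline\Omega}(G)<\epsilon$ and $u|_{\overline\Omega\setminus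 G}$ continuous; each $u\in\widetilde H^1(\Omega)$ has a relatively quasi-continuous representative on $\overline\Omega$, unique outside a set of zero relative capacity, and this representative is used in boundary integrals. A positive Borel measure $\mu$ on $\partial\Omega$ is smooth ($\mu\in S(\partial\Omega)$) if it charges no set of zero relative capacity and there is an increasing sequence $(F_n)$ of closed subsets of $\partial\Omega$ with $\mu(F_n)<\infty$ for all $n$ and $\lim_{n\to\infty}\mathrm{Cap}_{\overline\Omega}(K\setminus F_n)=0$ for every compact $K\subset\partial\Omega$. Let $(X_t,P_x)$ be the diffusion process on $\overline\Omega$ associated with $(\mathcal E,\mathcal F)$, and for $\mu\in S(\partial\Omega)$ let $A^\mu$ be the positive continuous additive functional of $(X_t)$ with Revuz measure $\mu$. For Borel $f$ on $\partial\Omega$ put $\|f\|_{rq}=\inf_{\mathrm{Cap}_{\overline\Omega}(N)=0}\sup_{x\in\partial\Omega\setminus N}|f(x)|$. The Kato class $S_K(\partial\Omega)$ is the set of $\mu\in S(\partial\Omega)$ with $\lim_{t\downarrow0}\|E_\cdot A_t^\mu\|_{rq}=0$. We write $\mu\in S(\partial\Omega)-S_K(\partial\Omega)$ if $\mu=\mu^+-\mu^-$ is a signed Borel measure on $\partial\Omega$ with $\mu^+\in S(\partial\Omega)$ and $\mu^-\in S_K(\partial\Omega)$; $|\mu|=\mu^++\mu^-$. For such $\mu$, $$\mathcal E_\mu(u,v)=\int_\Omega\nabla u\nabla v\,dx+\int_{\partial\Omega}uv\,d\mu,\qquad u,v\in\mathcal F^\mu=\widetilde H^1(\Omega)\cap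 L^2(\partial\Omega,|\mu|),$$ is a lower semibounded closed quadratic form on $L^2(\Omega)$, and $\Delta_\mu$ is the associated selfadjoint operator: $$D(\Delta_\mu)=\{u\in\mathcal F^\mu:\ \exists v\in L^2(\Omega)\ \text{with}\ \mathcal E_\mu(u,\varphi)=(v,\varphi)_{L^2(\Omega)}\ \forall\varphi\in\mathcal F^\mu\},\qquad \Delta_\mu u:=-v.$$ $\mathcal D(\Omega)$ is the space of smooth compactly supported functions on $\Omega$ and $\mathcal D(\Omega)'$ the space of distributions. *)

theory Defs
  imports "HOL-Probability.Probability"
begin

section \<open>Test functions and distributions\<close>

definition partial_deriv :: "'a::euclidean_space \<Rightarrow> ('a \<Rightarrow> real) \<Rightarrow> 'a \<Rightarrow> real" where
  "partial_deriv i f x = frechet_derivative f (at x) i"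

primrec iter_partial :: "'a::euclidean_space list \<Rightarrow> ('a \<Rightarrow> real) \<Rightarrow> 'a \<Rightarrow> real" where
  "iter_partial [] f = f"
| "iter_partial (i # is) f = partial_deriv i (iter_partial is f)"

definition smooth_fun :: "('a::euclidean_space \<Rightarrow> real) \<Rightarrow> bool" where
  "smooth_fun f \<longleftrightarrow> (\<forall>is. set is \<subseteq> Basis \<longrightarrow> iter_partial is f differentiable_on UNIV)"

text \<open>Test functions on \<open>\<Omega>\<close> are regarded as functions on the whole space, extended by zero.\<close>

definition test_funs :: "'a::euclidean_space set \<Rightarrow> ('a \<Rightarrow> real) set" where
  "test_funs \<Omega> = {\<phi>. smooth_fun \<phi> \<and> compact (closure {x. \<phi> x \<noteq> 0}) \<and> closure {x. \<phi> x \<noteq> 0} \<subseteq> \<Omega>}"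

text \<open>Distributions are represented by functionals of which only the values on \<^const>\<open>test_funs\<close> matter.\<close>

definition regular_distr :: "'a::euclidean_space set \<Rightarrow> ('a \<Rightarrow> real) \<Rightarrow> ('a \<Rightarrow> real) \<Rightarrow> real" where
  "regular_distr \<Omega> f \<phi> = (LINT x|lebesgue_on \<Omega>. f x * \<phi> x)"

definition distr_partial :: "'a::euclidean_space \<Rightarrow> (('a \<Rightarrow> real) \<Rightarrow> real) \<Rightarrow> ('a \<Rightarrow> real) \<Rightarrow> real" where
  "distr_partial i T \<phi> = - T (partial_deriv i \<phi>)"

definition distr_laplacian :: "(('a::euclidean_space \<Rightarrow> real) \<Rightarrow> real) \<Rightarrow> ('a \<Rightarrow> real) \<Rightarrow> real" where
  "distr_laplacian T \<phi> = (\<Sum>i\<in>Basis. distr_partial i (distr_partial i T) \<phi>)"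

definition distr_eq ::
  "'a::euclidean_space set \<Rightarrow> (('a \<Rightarrow> real) \<Rightarrow> real) \<Rightarrow> (('a \<Rightarrow> real) \<Rightarrow> real) \<Rightarrow> bool" where
  "distr_eq \<Omega> S T \<longleftrightarrow> (\<forall>\<phi>\<in>test_funs \<Omega>. S \<phi> = T \<phi>)"


section \<open>Square integrable functions and Sobolev spaces\<close>

text \<open>
  Elements of \<open>L\<^sup>2\<close> spaces are represented by functions; equality of elements is equality almost
  everywhere.  The reference measure \<open>m(A) = \<lambda>(A \<inter> \<Omega>)\<close> on \<open>closure \<Omega>\<close> does not charge the
  boundary, so \<open>L\<^sup>2(closure \<Omega>, m)\<close> is rendered by \<^term>\<open>lebesgue_on \<Omega>\<close>, and the
  values of representatives off \<open>\<Omega>\<close> are irrelevant.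
\<close>

definition square_integrable :: "'a measure \<Rightarrow> ('a \<Rightarrow> real) set" where
  "square_integrable M = {f \<in> borel_measurable M. integrable M (\<lambda>x. (f x)\<^sup>2)}"

abbreviation L2 :: "'a::euclidean_space set \<Rightarrow> ('a \<Rightarrow> real) set" where
  "L2 \<Omega> \<equiv> square_integrable (lebesgue_on \<Omega>)"

definition L2_inner :: "'a::euclidean_space set \<Rightarrow> ('a \<Rightarrow> real) \<Rightarrow> ('a \<Rightarrow> real) \<Rightarrow> real" where
  "L2_inner \<Omega> u v = (LINT x|lebesgue_on \<Omega>. u x * v x)"

definition L2_norm :: "'a::euclidean_space set \<Rightarrow> ('a \<Rightarrow> real) \<Rightarrow> real" where
  "L2_norm \<Omega> u = sqrt (L2_inner \<Omega> u u)"

definition is_weak_gradient :: "'a::euclidean_space set \<Rightarrow> ('a \<Rightarrow> real) \<Rightarrow> ('a \<Rightarrow> 'a) \<Rightarrow> bool" where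
  "is_weak_gradient \<Omega> u g \<longleftrightarrow>
     (\<forall>i\<in>Basis. (\<lambda>x. g x \<bullet> i) \<in> L2 \<Omega> \<and>
        distr_eq \<Omega> (regular_distr \<Omega> (\<lambda>x. g x \<bullet> i)) (distr_partial i (regular_distr \<Omega> u)))"

definition H1 :: "'a::euclidean_space set \<Rightarrow> ('a \<Rightarrow> real) set" where
  "H1 \<Omega> = {u \<in> L2 \<Omega>. \<exists>g. is_weak_gradient \<Omega> u g}"

text \<open>Unique almost everywhere on \<open>\<Omega>\<close>.\<close>

definition weak_grad :: "'a::euclidean_space set \<Rightarrow> ('a \<Rightarrow> real) \<Rightarrow> 'a \<Rightarrow> 'a" where
  "weak_grad \<Omega> u = (SOME g. is_weak_gradient \<Omega> u g)"

definition dirichlet :: "'a::euclidean_space set \<Rightarrow> ('a \<Rightarrow> real) \<Rightarrow> ('a \<Rightarrow> real) \<Rightarrow> real" where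
  "dirichlet \<Omega> u v = (LINT x|lebesgue_on \<Omega>. weak_grad \<Omega> u x \<bullet> weak_grad \<Omega> v x)"

definition dirichlet1 :: "'a::euclidean_space set \<Rightarrow> ('a \<Rightarrow> real) \<Rightarrow> ('a \<Rightarrow> real) \<Rightarrow> real" where
  "dirichlet1 \<Omega> u v = dirichlet \<Omega> u v + L2_inner \<Omega> u v"

definition Cc_closure :: "'a::euclidean_space set \<Rightarrow> ('a \<Rightarrow> real) set" where
  "Cc_closure \<Omega> = {w. continuous_on (closure \<Omega>) w \<and>
     (\<exists>K. compact K \<and> K \<subseteq> closure \<Omega> \<and> (\<forall>x\<in>closure \<Omega> - K. w x = 0))}"

definition H1_tilde :: "'a::euclidean_space set \<Rightarrow> ('a \<Rightarrow> real) set" where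
  "H1_tilde \<Omega> = {u \<in> H1 \<Omega>. \<exists>w :: nat \<Rightarrow> 'a \<Rightarrow> real. (\<forall>n. w n \<in> H1 \<Omega> \<inter> Cc_closure \<Omega>) \<and>
     (\<lambda>n. dirichlet1 \<Omega> (\<lambda>x. u x - w n x) (\<lambda>x. u x - w n x)) \<longlonglongrightarrow> 0}"


section \<open>Relative capacity, quasi-continuity, smooth measures\<close>

definition cap_open :: "'a::euclidean_space set \<Rightarrow> 'a set \<Rightarrow> ennreal" where
  "cap_open \<Omega> A =
     (INF u\<in>{u \<in> H1_tilde \<Omega>. AE x in lebesgue_on \<Omega>. x \<in> A \<longrightarrow> 1 \<le> u x}. ennreal (dirichlet1 \<Omega> u u))"

definition rel_cap :: "'a::euclidean_space set \<Rightarrow> 'a set \<Rightarrow> ennreal" where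
  "rel_cap \<Omega> A = (INF B\<in>{B. openin (top_of_set (closure \<Omega>)) B \<and> A \<subseteq> B}. cap_open \<Omega> B)"

definition quasi_continuous :: "'a::euclidean_space set \<Rightarrow> ('a \<Rightarrow> real) \<Rightarrow> bool" where
  "quasi_continuous \<Omega> f \<longleftrightarrow> (\<forall>\<epsilon>>0. \<exists>G. openin (top_of_set (closure \<Omega>)) G \<and>
     rel_cap \<Omega> G < \<epsilon> \<and> continuous_on (closure \<Omega> - G) f)"

text \<open>Unique on \<open>closure \<Omega>\<close> outside a set of zero relative capacity.\<close>

definition qc_rep :: "'a::euclidean_space set \<Rightarrow> ('a \<Rightarrow> real) \<Rightarrow> 'a \<Rightarrow> real" where
  "qc_rep \<Omega> u = (SOME f. quasi_continuous \<Omega> f \<and> (AE x in lebesgue_on \<Omega>. f x = u x))"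

definition boundary_measure :: "'a::euclidean_space set \<Rightarrow> 'a measure \<Rightarrow> bool" where
  "boundary_measure \<Omega> \<mu> \<longleftrightarrow> sets \<mu> = sets (restrict_space borel (frontier \<Omega>))"

definition smooth_measure :: "'a::euclidean_space set \<Rightarrow> 'a measure \<Rightarrow> bool" where
  "smooth_measure \<Omega> \<mu> \<longleftrightarrow> boundary_measure \<Omega> \<mu> \<and>
     (\<forall>A\<in>sets \<mu>. rel_cap \<Omega> A = 0 \<longrightarrow> emeasure \<mu> A = 0) \<and>
     (\<exists>F :: nat \<Rightarrow> 'a set. incseq F \<and>
        (\<forall>n. closed (F n) \<and> F n \<subseteq> frontier \<Omega> \<and> emeasure \<mu> (F n) < \<infinity>) \<and>
        (\<forall>K. compact K \<and> K \<subseteq> frontier \<Omega> \<longrightarrow> (\<lambda>n. rel_cap \<Omega> (K - F n)) \<longlonglongrightarrow> 0))"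


section \<open>Diffusion processes on the closure of \<open>\<Omega>\<close>\<close>

text \<open>
  The state space is \<open>closure \<Omega>\<close> with a cemetery \<^const>\<open>None\<close> adjoined: the point at infinity of the
  one-point compactification, isolated if \<open>closure \<Omega>\<close> is compact.  Time runs through \<open>[0,\<infinity>]\<close>, i.e.
  \<^typ>\<open>ennreal\<close>, the process being in the cemetery at time \<open>\<infinity>\<close>.  The components of a
  process are the sample space, the coordinate variables, the shifts and the laws indexed by the
  starting point; the laws live on the sigma-algebra generated by the process.
\<close>

definition state_top :: "'a::euclidean_space set \<Rightarrow> 'a option topology" where
  "state_top \<Omega> = Alexandroff_compactification (top_of_set (closure \<Omega>))"

definition state_borel :: "'a::euclidean_space set \<Rightarrow> 'a option measure" where
  "state_borel \<Omega> = sigma (topspace (state_top \<Omega>)) {U. openin (state_top \<Omega>) U}"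

record ('w, 'a) markov_process =
  paths :: "'w set"
  coord :: "ennreal \<Rightarrow> 'w \<Rightarrow> 'a option"
  shift :: "ennreal \<Rightarrow> 'w \<Rightarrow> 'w"
  law :: "'a option \<Rightarrow> 'w measure"

definition natural_filtration ::
  "'a::euclidean_space set \<Rightarrow> ('w, 'a) markov_process \<Rightarrow> ennreal \<Rightarrow> 'w measure" where
  "natural_filtration \<Omega> X t = sigma (paths X)
     {coord X s -` B \<inter> paths X | s B. s \<le> t \<and> B \<in> sets (state_borel \<Omega>)}"

abbreviation initial_laws :: "'a::euclidean_space set \<Rightarrow> 'a option measure set" where
  "initial_laws \<Omega> \<equiv> space (prob_algebra (state_borel \<Omega>))"

text \<open>The completed law of the process with initial distribution \<open>\<nu>\<close>.\<close>

definition law_from :: "('w, 'a) markov_process \<Rightarrow> 'a option measure \<Rightarrow> 'w measure" where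
  "law_from X \<nu> = completion (\<nu> \<bind> law X)"

abbreviation law_at :: "('w, 'a) markov_process \<Rightarrow> 'a \<Rightarrow> 'w measure" where
  "law_at X x \<equiv> completion (law X (Some x))"

text \<open>The minimal completed admissible filtration.\<close>

definition admissible_filtration ::
  "'a::euclidean_space set \<Rightarrow> ('w, 'a) markov_process \<Rightarrow> ennreal \<Rightarrow> 'w measure" where
  "admissible_filtration \<Omega> X t = sigma (paths X)
     (\<Inter>\<nu>\<in>initial_laws \<Omega>. sigma_sets (paths X)
        (sets (natural_filtration \<Omega> X t) \<union> null_sets (law_from X \<nu>)))"

definition hunt_process :: "'a::euclidean_space set \<Rightarrow> ('w, 'a) markov_process \<Rightarrow> bool" where
  "hunt_process \<Omega> X \<longleftrightarrow>
     \<comment> \<open>measurability and normality\<close>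
     (\<forall>t. coord X t \<in> paths X \<rightarrow> topspace (state_top \<Omega>)) \<and>
     law X \<in> state_borel \<Omega> \<rightarrow>\<^sub>M prob_algebra (natural_filtration \<Omega> X \<infinity>) \<and>
     (\<forall>x\<in>topspace (state_top \<Omega>). AE \<omega> in law X x. coord X 0 \<omega> = x) \<and>
     \<comment> \<open>sample paths and shifts\<close>
     (\<forall>\<omega>\<in>paths X.
        coord X \<infinity> \<omega> = None \<and>
        (\<forall>s t. s \<le> t \<and> coord X s \<omega> = None \<longrightarrow> coord X t \<omega> = None) \<and>
        (\<forall>t. shift X t \<omega> \<in> paths X \<and> (\<forall>s. coord X s (shift X t \<omega>) = coord X (t + s) \<omega>)) \<and>
        (\<forall>t<\<infinity>. limitin (state_top \<Omega>) (\<lambda>s. coord X s \<omega>) (coord X t \<omega>) (at_right t)) \<and>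
        (\<forall>t. 0 < t \<and> t < \<infinity> \<longrightarrow> (\<exists>l. limitin (state_top \<Omega>) (\<lambda>s. coord X s \<omega>) l (at_left t)))) \<and>
     \<comment> \<open>strong Markov property\<close>
     (\<forall>\<nu>\<in>initial_laws \<Omega>. \<forall>\<sigma>. stopping_time (admissible_filtration \<Omega> X) \<sigma> \<longrightarrow>
        (\<forall>\<Lambda>\<in>sets (filtration.pre_sigma (paths X) (admissible_filtration \<Omega> X) \<sigma>).
         \<forall>s. \<forall>B\<in>sets (state_borel \<Omega>).
           emeasure (law_from X \<nu>) {\<omega> \<in> \<Lambda>. coord X (\<sigma> \<omega> + s) \<omega> \<in> B} =
           (\<integral>\<^sup>+\<omega>\<in>\<Lambda>. emeasure (law X (coord X (\<sigma> \<omega>) \<omega>)) {\<omega>' \<in> paths X. coord X s \<omega>' \<in> B}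
              \<partial>law_from X \<nu>))) \<and>
     \<comment> \<open>quasi-left continuity\<close>
     (\<forall>\<nu>\<in>initial_laws \<Omega>. \<forall>\<sigma> :: nat \<Rightarrow> 'w \<Rightarrow> ennreal.
        (\<forall>n. stopping_time (admissible_filtration \<Omega> X) (\<sigma> n)) \<and> incseq \<sigma> \<longrightarrow>
        (AE \<omega> in law_from X \<nu>. (SUP n. \<sigma> n \<omega>) < \<infinity> \<longrightarrow>
           limitin (state_top \<Omega>) (\<lambda>n. coord X (\<sigma> n \<omega>) \<omega>) (coord X (SUP n. \<sigma> n \<omega>) \<omega>) sequentially))"

text \<open>The set of times \<open>t\<close> with \<open>coord X t \<omega> \<noteq> None\<close> is the interval from \<open>0\<close> up to the lifetime.\<close>

definition diffusion :: "'a::euclidean_space set \<Rightarrow> ('w, 'a) markov_process \<Rightarrow> bool" where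
  "diffusion \<Omega> X \<longleftrightarrow> hunt_process \<Omega> X \<and>
     (\<forall>x\<in>closure \<Omega>. AE \<omega> in law_at X x.
        continuous_map (top_of_set {t. coord X t \<omega> \<noteq> None}) (state_top \<Omega>) (\<lambda>t. coord X t \<omega>))"

text \<open>
  The strongly continuous contraction semigroup on \<open>L\<^sup>2(\<Omega>)\<close> whose generator is the operator
  associated with the form \<^const>\<open>dirichlet\<close> on the domain \<^const>\<open>H1_tilde\<close>.
\<close>

definition form_semigroup ::
  "'a::euclidean_space set \<Rightarrow> (real \<Rightarrow> ('a \<Rightarrow> real) \<Rightarrow> 'a \<Rightarrow> real) \<Rightarrow> bool" where
  "form_semigroup \<Omega> T \<longleftrightarrow>
     (\<forall>t\<ge>0. \<forall>f\<in>L2 \<Omega>. T t f \<in> L2 \<Omega> \<and> L2_norm \<Omega> (T t f) \<le> L2_norm \<Omega> f) \<and>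
     (\<forall>t\<ge>0. \<forall>f\<in>L2 \<Omega>. \<forall>g\<in>L2 \<Omega>. \<forall>a b. AE x in lebesgue_on \<Omega>.
        T t (\<lambda>y. a * f y + b * g y) x = a * T t f x + b * T t g x) \<and>
     (\<forall>f\<in>L2 \<Omega>. AE x in lebesgue_on \<Omega>. T 0 f x = f x) \<and>
     (\<forall>s\<ge>0. \<forall>t\<ge>0. \<forall>f\<in>L2 \<Omega>. AE x in lebesgue_on \<Omega>. T (s + t) f x = T s (T t f) x) \<and>
     (\<forall>f\<in>L2 \<Omega>. ((\<lambda>t. L2_norm \<Omega> (\<lambda>x. T t f x - f x)) \<longlongrightarrow> 0) (at_right 0)) \<and>
     (\<forall>u\<in>L2 \<Omega>. \<forall>w\<in>L2 \<Omega>.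
        ((\<lambda>t. L2_norm \<Omega> (\<lambda>x. (T t u x - u x) / t - w x)) \<longlongrightarrow> 0) (at_right 0) \<longleftrightarrow>
        u \<in> H1_tilde \<Omega> \<and> (\<forall>\<phi>\<in>H1_tilde \<Omega>. dirichlet \<Omega> u \<phi> = - L2_inner \<Omega> w \<phi>))"

text \<open>Functions on the state space are extended by \<open>0\<close> to the cemetery.\<close>

definition transition ::
  "('w, 'a) markov_process \<Rightarrow> real \<Rightarrow> ('a \<Rightarrow> real) \<Rightarrow> 'a \<Rightarrow> real" where
  "transition X t f x =
     (LINT \<omega>|law X (Some x). (case coord X (ennreal t) \<omega> of None \<Rightarrow> 0 | Some y \<Rightarrow> f y))"

definition associated_diffusion :: "'a::euclidean_space set \<Rightarrow> ('w, 'a) markov_process \<Rightarrow> bool" where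
  "associated_diffusion \<Omega> X \<longleftrightarrow> diffusion \<Omega> X \<and>
     (\<exists>T. form_semigroup \<Omega> T \<and>
        (\<forall>t\<ge>0. \<forall>f\<in>borel_measurable borel \<inter> L2 \<Omega>. bounded (range f) \<longrightarrow>
           (AE x in lebesgue_on \<Omega>. transition X t f x = T t f x)))"


section \<open>Additive functionals, Revuz measures and the Kato class\<close>

definition lifetime :: "('w, 'a) markov_process \<Rightarrow> 'w \<Rightarrow> ennreal" where
  "lifetime X \<omega> = Inf {t. coord X t \<omega> = None}"

definition pcaf ::
  "'a::euclidean_space set \<Rightarrow> ('w, 'a) markov_process \<Rightarrow> (ennreal \<Rightarrow> 'w \<Rightarrow> ennreal) \<Rightarrow> bool" where
  "pcaf \<Omega> X A \<longleftrightarrow>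
     (\<forall>t<\<infinity>. A t \<in> borel_measurable (admissible_filtration \<Omega> X t)) \<and>
     (\<exists>\<Lambda> N. \<Lambda> \<in> sets (admissible_filtration \<Omega> X \<infinity>) \<and> N \<subseteq> closure \<Omega> \<and> rel_cap \<Omega> N = 0 \<and>
        (\<forall>x\<in>closure \<Omega> - N. emeasure (law_at X x) \<Lambda> = 1) \<and>
        (\<forall>t. 0 < t \<and> t < \<infinity> \<longrightarrow> shift X t ` \<Lambda> \<subseteq> \<Lambda>) \<and>
        (\<forall>\<omega>\<in>\<Lambda>.
           continuous_on {..<\<infinity>} (\<lambda>t. A t \<omega>) \<and> A 0 \<omega> = 0 \<and>
           (\<forall>t<lifetime X \<omega>. A t \<omega> < \<infinity>) \<and>
           (\<forall>t. lifetime X \<omega> \<le> t \<and> t < \<infinity> \<longrightarrow> A t \<omega> = A (lifetime X \<omega>) \<omega>) \<and>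
           (\<forall>s<\<infinity>. \<forall>t<\<infinity>. A (t + s) \<omega> = A t \<omega> + A s (shift X t \<omega>))))"

text \<open>
  The integral of \<open>g \<ge> 0\<close> over \<open>{0..t}\<close> against the Stieltjes measure of a continuous nondecreasing
  \<open>a\<close> with \<open>a 0 = 0\<close>.  As \<open>a\<close> may reach \<open>\<infinity>\<close>, it is truncated at level \<open>n\<close>: the measure of
  \<open>min a n\<close> is the restriction of that of \<open>a\<close> to the times at which \<open>a \<le> n\<close>, so the supremum is the
  integral over the times at which \<open>a\<close> is finite.  In the use below \<open>g\<close> vanishes from the lifetime on.
\<close>

definition stieltjes_integral :: "(ennreal \<Rightarrow> ennreal) \<Rightarrow> (real \<Rightarrow> ennreal) \<Rightarrow> real \<Rightarrow> ennreal" where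
  "stieltjes_integral a g t = (SUP n :: nat. \<integral>\<^sup>+s\<in>{0..t}. g s
     \<partial>interval_measure (\<lambda>s. if s \<le> 0 then 0 else enn2real (min (a (ennreal s)) (of_nat n))))"

text \<open>
  \<open>\<mu>\<close>, viewed as a measure on \<open>closure \<Omega>\<close> carried by the boundary, is the Revuz measure of \<open>A\<close>:
  \<open>\<integral> f d\<mu> = lim\<^bsub>t\<down>0\<^esub> 1/t E\<^sub>m[\<integral>\<^sub>0\<^sup>t f(X\<^sub>s) dA\<^sub>s]\<close> for all Borel \<open>f \<ge> 0\<close>.
\<close>

definition revuz_measure ::
  "'a::euclidean_space set \<Rightarrow> ('w, 'a) markov_process \<Rightarrow> (ennreal \<Rightarrow> 'w \<Rightarrow> ennreal) \<Rightarrow> 'a measure \<Rightarrow> bool" where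
  "revuz_measure \<Omega> X A \<mu> \<longleftrightarrow> (\<forall>f \<in> borel_measurable borel.
     ((\<lambda>t. ennreal (1 / t) * (\<integral>\<^sup>+x. \<integral>\<^sup>+\<omega>.
          stieltjes_integral (\<lambda>s. A s \<omega>)
            (\<lambda>s. case coord X (ennreal s) \<omega> of None \<Rightarrow> 0 | Some y \<Rightarrow> f y) t
          \<partial>law_at X x \<partial>lebesgue_on \<Omega>))
      \<longlongrightarrow> (\<integral>\<^sup>+x. f x \<partial>\<mu>)) (at_right 0))"

definition rq_norm :: "'a::euclidean_space set \<Rightarrow> ('a \<Rightarrow> ereal) \<Rightarrow> ennreal" where
  "rq_norm \<Omega> f =
     (INF N\<in>{N. N \<subseteq> closure \<Omega> \<and> rel_cap \<Omega> N = 0}. SUP x\<in>frontier \<Omega> - N. e2ennreal \<bar>f x\<bar>)"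

text \<open>The positive continuous additive functional with a given Revuz measure is unique up to equivalence.\<close>

definition kato_class :: "'a::euclidean_space set \<Rightarrow> ('w, 'a) markov_process \<Rightarrow> 'a measure \<Rightarrow> bool" where
  "kato_class \<Omega> X \<mu> \<longleftrightarrow> smooth_measure \<Omega> \<mu> \<and>
     (\<exists>A. pcaf \<Omega> X A \<and> revuz_measure \<Omega> X A \<mu> \<and>
        ((\<lambda>t. rq_norm \<Omega> (\<lambda>x. enn2ereal (\<integral>\<^sup>+\<omega>. A t \<omega> \<partial>law_at X x))) \<longlongrightarrow> 0) (at_right 0))"


section \<open>The operator\<close>

text \<open>
  The signed measure \<open>\<mu> = \<mu>\<^sup>+ - \<mu>\<^sup>-\<close> is given by the pair \<open>\<mu>p\<close>, \<open>\<mu>m\<close>, which covers the Jordan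
  decomposition; both may be infinite, so that \<open>\<mu>\<close> itself need not be a set function.
\<close>

definition smooth_minus_kato ::
  "'a::euclidean_space set \<Rightarrow> ('w, 'a) markov_process \<Rightarrow> 'a measure \<Rightarrow> 'a measure \<Rightarrow> bool" where
  "smooth_minus_kato \<Omega> X \<mu>p \<mu>m \<longleftrightarrow> smooth_measure \<Omega> \<mu>p \<and> kato_class \<Omega> X \<mu>m"

definition total_var :: "'a measure \<Rightarrow> 'a measure \<Rightarrow> 'a measure" where
  "total_var \<mu>p \<mu>m = measure_of (space \<mu>p) (sets \<mu>p) (\<lambda>A. emeasure \<mu>p A + emeasure \<mu>m A)"

text \<open>
  Boundary integrals are taken with respect to completed measures because a quasi-continuous function
  is Borel only up to a set of zero relative capacity.
\<close>

definition form_dom :: "'a::euclidean_space set \<Rightarrow> 'a measure \<Rightarrow> 'a measure \<Rightarrow> ('a \<Rightarrow> real) set" where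
  "form_dom \<Omega> \<mu>p \<mu>m =
     {u \<in> H1_tilde \<Omega>. qc_rep \<Omega> u \<in> square_integrable (completion (total_var \<mu>p \<mu>m))}"

definition form_mu :: "'a::euclidean_space set \<Rightarrow> 'a measure \<Rightarrow> 'a measure \<Rightarrow>
    ('a \<Rightarrow> real) \<Rightarrow> ('a \<Rightarrow> real) \<Rightarrow> real" where
  "form_mu \<Omega> \<mu>p \<mu>m u v = dirichlet \<Omega> u v +
     ((LINT x|completion \<mu>p. qc_rep \<Omega> u x * qc_rep \<Omega> v x) -
      (LINT x|completion \<mu>m. qc_rep \<Omega> u x * qc_rep \<Omega> v x))"

text \<open>
  The graph of \<open>\<Delta>\<^sub>\<mu>\<close>: all pairs of representatives of \<open>u \<in> D(\<Delta>\<^sub>\<mu>)\<close> and of \<open>\<Delta>\<^sub>\<mu> u\<close>.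
\<close>

definition Delta_mu :: "'a::euclidean_space set \<Rightarrow> 'a measure \<Rightarrow> 'a measure \<Rightarrow>
    (('a \<Rightarrow> real) \<times> ('a \<Rightarrow> real)) set" where
  "Delta_mu \<Omega> \<mu>p \<mu>m = {(u, \<lambda>x. - v x) | u v. u \<in> form_dom \<Omega> \<mu>p \<mu>m \<and> v \<in> L2 \<Omega> \<and>
     (\<forall>\<phi>\<in>form_dom \<Omega> \<mu>p \<mu>m. form_mu \<Omega> \<mu>p \<mu>m u \<phi> = L2_inner \<Omega> v \<phi>)}"

end

theory Submission
  imports Defs
begin

text \<open>
  Let \<open>\<phi>\<close> be a test function. A quasi-continuous representative of \<open>\<phi>\<close> agrees with \<open>\<phi>\<close>
  outside a set of zero relative capacity, hence vanishes almost everywhere with respect to every smooth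
  measure on the boundary. So \<open>\<phi>\<close> lies in the form domain, the boundary terms in \<open>\<E>\<^sub>\<mu>(u, \<phi>)\<close>
  disappear, and \<open>\<E>\<^sub>\<mu>(u, \<phi>) = (v, \<phi>)\<close> becomes the weak form of \<open>- \<Delta>u = v\<close>. As \<^const>\<open>weak_grad\<close> is
  an arbitrary choice, the weak gradient has to be shown unique almost everywhere.
\<close>

section \<open>Smooth functions and bump functions\<close>

text \<open>Two facts carry the weight. One is that adding a Lebesgue null set to a relatively open
  set, with the union still relatively open, costs no capacity, since admissible functions are
  constrained only almost everywhere. Outside a small exceptional open set, the points where two
  functions equal almost everywhere still differ can therefore be adjoined for free, which upgrades
  equality almost everywhere to equality up to zero relative capacity. The other is the fundamental
  lemma of the calculus of variations: testing against smooth approximations of box indicators makes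
  the integrals over all boxes inside \<Omega> vanish, and Lebesgue differentiation over shrinking
  cubes recovers the integrand. Uniqueness of weak gradients matters even for the zero function:
  both the membership of test functions in \<open>H1_tilde\<close> and the vanishing capacity of the
  empty set go through \<open>dirichlet1\<close> of zero. Boundary values of a test function vanish
  because its support is contained in the open set \<Omega>, which is disjoint from its
  frontier.\<close>

primrec kdiff :: "nat \<Rightarrow> ('a::euclidean_space \<Rightarrow> real) \<Rightarrow> bool" where
  "kdiff 0 f \<longleftrightarrow> True"
| "kdiff (Suc n) f \<longleftrightarrow> f differentiable_on UNIV \<and> (\<forall>i\<in>Basis. kdiff n (partial_deriv i f))"

lemma iter_partial_append: "iter_partial (is @ js) f = iter_partial is (iter_partial js f)"
  by (induction "is") auto

text \<open>The head of the list is the derivative taken last, whereas \<open>kdiff\<close> peels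
  off the one taken first; hence the induction from the right end. Peeling in this order turns
  closure under sums and products into an induction on the order with the functions
  generalized.\<close>

lemma kdiff_iter_partial:
  "kdiff (Suc (length is)) f \<Longrightarrow> set is \<subseteq> Basis \<Longrightarrow> iter_partial is f differentiable_on UNIV"
  by (induction "is" arbitrary: f rule: rev_induct) (auto simp: iter_partial_append)

lemma smooth_funI: "(\<And>n. kdiff n f) \<Longrightarrow> smooth_fun f"
  unfolding smooth_fun_def using kdiff_iter_partial by blast

lemma smooth_fun_differentiable: "smooth_fun f \<Longrightarrow> f differentiable at x"
  unfolding smooth_fun_def by (auto dest!: spec[of _ "[]"] simp: differentiable_on_def)

lemma smooth_fun_partial:
  assumes "smooth_fun f" "i \<in> Basis"
  shows "smooth_fun (partial_deriv i f)"
  unfolding smooth_fun_def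
proof (intro allI impI)
  fix "is" :: "'a list"
  assume "set is \<subseteq> Basis"
  then have "iter_partial (is @ [i]) f differentiable_on UNIV"
    using assms unfolding smooth_fun_def by (metis Un_subset_iff empty_set insert_subset list.simps(15) set_append empty_subsetI)
  then show "iter_partial is (partial_deriv i f) differentiable_on UNIV"
    by (simp add: iter_partial_append)
qed

lemma smooth_fun_continuous: "smooth_fun f \<Longrightarrow> continuous_on UNIV f"
  unfolding smooth_fun_def
  by (auto dest!: spec[of _ "[]"] intro: differentiable_imp_continuous_on)

lemma kdiff_mono: "kdiff (Suc n) f \<Longrightarrow> kdiff n f"
  by (induction n arbitrary: f) auto

lemma partial_derivI: "(f has_derivative f') (at x) \<Longrightarrow> partial_deriv i f x = f' i"
  unfolding partial_deriv_def by (simp add: frechet_derivative_at[symmetric])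

lemma has_derivative_differentiable:
  "f differentiable at x \<Longrightarrow> (f has_derivative (\<lambda>h. frechet_derivative f (at x) h)) (at x)"
  using frechet_derivative_works by blast

section \<open>Sum and product rules at every order\<close>

lemma partial_deriv_mult:
  assumes "f differentiable_on UNIV" "g differentiable_on UNIV"
  shows "partial_deriv i (\<lambda>x. f x * g x) = (\<lambda>x. f x * partial_deriv i g x + partial_deriv i f x * g x)"
proof
  fix x
  have f: "f differentiable at x" and g: "g differentiable at x"
    using assms by (auto simp: differentiable_on_def)
  show "partial_deriv i (\<lambda>x. f x * g x) x = f x * partial_deriv i g x + partial_deriv i f x * g x"
    using partial_derivI[OF has_derivative_mult[OF has_derivative_differentiable[OF f]
        has_derivative_differentiable[OF g]]]
    by (simp add: partial_deriv_def)
qed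

lemma partial_deriv_add:
  assumes "f differentiable_on UNIV" "g differentiable_on UNIV"
  shows "partial_deriv i (\<lambda>x. f x + g x) = (\<lambda>x. partial_deriv i f x + partial_deriv i g x)"
proof
  fix x
  have f: "f differentiable at x" and g: "g differentiable at x"
    using assms by (auto simp: differentiable_on_def)
  show "partial_deriv i (\<lambda>x. f x + g x) x = partial_deriv i f x + partial_deriv i g x"
    using partial_derivI[OF has_derivative_add[OF has_derivative_differentiable[OF f]
        has_derivative_differentiable[OF g]]]
    by (simp add: partial_deriv_def)
qed

lemma kdiff_add: "kdiff n f \<Longrightarrow> kdiff n g \<Longrightarrow> kdiff n (\<lambda>x. f x + g x)"
  by (induction n arbitrary: f g) (auto simp: partial_deriv_add)

lemma kdiff_mult: "kdiff n f \<Longrightarrow> kdiff n g \<Longrightarrow> kdiff n (\<lambda>x. f x * g x)"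
proof (induction n arbitrary: f g)
  case (Suc n)
  then show ?case
    \<comment> \<open>The product rule leaves one factor undifferentiated in each summand, so each
      factor is also needed at the lower order.\<close>
    using kdiff_mono[OF Suc.prems(1)] kdiff_mono[OF Suc.prems(2)]
    by (auto simp: partial_deriv_mult intro!: kdiff_add)
qed simp

lemma kdiff_const: "kdiff n (\<lambda>x. c)"
proof (induction n arbitrary: c)
  case (Suc n)
  have "partial_deriv i (\<lambda>x. c) = (\<lambda>x. 0)" for i :: 'a
    using partial_derivI[OF has_derivative_const] by auto
  with Suc show ?case by simp
qed simp

lemma kdiff_prod: "finite I \<Longrightarrow> (\<And>i. i \<in> I \<Longrightarrow> kdiff n (f i)) \<Longrightarrow> kdiff n (\<lambda>x. \<Prod>i\<in>I. f i x)"
  by (induction I rule: finite_induct) (auto intro: kdiff_mult kdiff_const)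

text \<open>The case \<open>k = 0\<close> is the classical smooth function exp(-1/t), flat at 0. The
  powers of 1/t are carried along because differentiation stays within the span of the
  family.\<close>

definition flat_exp :: "nat \<Rightarrow> real \<Rightarrow> real" where
  "flat_exp k t = (if t > 0 then inverse t ^ k * exp (- inverse t) else 0)"

lemma flat_exp_tendsto_0: "(flat_exp k \<longlongrightarrow> 0) (at 0)"
proof -
  have "((\<lambda>t. inverse t ^ k / exp (inverse t)) \<longlongrightarrow> (0::real)) (at_right 0)"
    by (rule filterlim_compose[OF tendsto_power_div_exp_0 filterlim_inverse_at_top_right])
  then have "(flat_exp k \<longlongrightarrow> 0) (at_right 0)"
    by (rule Lim_transform_eventually)
      (auto simp: eventually_at_right_field flat_exp_def exp_minus field_simps intro: exI[of _ 1])
  moreover have "(flat_exp k \<longlongrightarrow> 0) (at_left 0)"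
    by (rule Lim_transform_eventually[OF tendsto_const])
      (auto simp: eventually_at_left_field flat_exp_def intro: exI[of _ "-1"])
  ultimately show ?thesis by (simp add: filterlim_split_at)
qed

lemma flat_exp_deriv:
  "(flat_exp k has_real_derivative flat_exp (k + 2) t - real k * flat_exp (k + 1) t) (at t)"
proof -
  consider "t > 0" | "t < 0" | "t = 0" by linarith
  then show ?thesis
  proof cases
    case 1
    have "((\<lambda>t. inverse t ^ k * exp (- inverse t)) has_real_derivative
        flat_exp (k + 2) t - real k * flat_exp (k + 1) t) (at t)"
      using 1 by (auto intro!: derivative_eq_intros
          simp: flat_exp_def power_eq_if[of "inverse t" k] algebra_simps power2_eq_square)
    then show ?thesis
      by (rule has_field_derivative_transform_within_open[of _ _ _ "{0<..}"])
        (use 1 in \<open>auto simp: flat_exp_def\<close>)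
  next
    case 2
    have "((\<lambda>t. 0) has_real_derivative flat_exp (k + 2) t - real k * flat_exp (k + 1) t) (at t)"
      using 2 by (simp add: flat_exp_def)
    then show ?thesis
      by (rule has_field_derivative_transform_within_open[of _ _ _ "{..<0}"])
        (use 2 in \<open>auto simp: flat_exp_def\<close>)
  next
    case 3
    \<comment> \<open>At the origin the difference quotient is the next member of the family, which
      tends to 0.\<close>
    have "flat_exp k (0 + h) = flat_exp (Suc k) h * h" for h
      by (auto simp: flat_exp_def)
    then have "(\<lambda>h. (flat_exp k (0 + h) - flat_exp k 0) / h) \<midarrow>0\<rightarrow> 0"
      using flat_exp_tendsto_0[of "Suc k"]
      by (elim Lim_transform_eventually) (auto simp: eventually_at_filter flat_exp_def)
    then show ?thesis using 3 by (simp add: DERIV_def flat_exp_def)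
  qed
qed

lemma flat_exp_bounds: "0 \<le> flat_exp 0 t" "flat_exp 0 t \<le> 1"
  by (auto simp: flat_exp_def)

lemma kdiff_flat_exp: "kdiff n (\<lambda>x::'a::euclidean_space. flat_exp k (c * (x \<bullet> j) + d))"
proof (induction n arbitrary: k)
  case (Suc n)
  have D: "((\<lambda>x::'a. flat_exp k (c * (x \<bullet> j) + d)) has_derivative
     (\<lambda>h. (flat_exp (k + 2) (c * (x \<bullet> j) + d) - real k * flat_exp (k + 1) (c * (x \<bullet> j) + d)) * (c * (h \<bullet> j)))) (at x)" for x
    by (rule has_derivative_eq_rhs[OF DERIV_compose_FDERIV[OF flat_exp_deriv]])
      (auto intro!: derivative_eq_intros simp: fun_eq_iff)
  have "(\<lambda>x::'a. flat_exp k (c * (x \<bullet> j) + d)) differentiable_on UNIV"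
    using D by (auto simp: differentiable_on_def differentiable_def)
  \<comment> \<open>The difference is written as a sum with a constant factor
    \<open>- real k\<close>, the shape that \<open>kdiff_add\<close>, \<open>kdiff_mult\<close> and
    \<open>kdiff_const\<close> can take apart.\<close>
  moreover have "partial_deriv i (\<lambda>x. flat_exp k (c * (x \<bullet> j) + d)) =
     (\<lambda>x. (flat_exp (k + 2) (c * (x \<bullet> j) + d) + (- real k) * flat_exp (k + 1) (c * (x \<bullet> j) + d)) * (c * (i \<bullet> j)))" for i :: 'a
    using partial_derivI[OF D] by (auto simp: fun_eq_iff)
  ultimately show ?case
    by (simp only: kdiff.simps) (intro conjI ballI kdiff_mult kdiff_add kdiff_const Suc TrueI)
qed simp

text \<open>A product of one-variable bumps that is positive exactly on the open box when
  \<open>s > 0\<close>. As \<open>s\<close> grows, each factor exp(-1/(s t)) with t > 0 tends to 1,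
  so these functions approximate the indicator of the box without any mollification. The arguments
  are expanded to match \<open>kdiff_flat_exp\<close>.\<close>

definition box_bump :: "'a::euclidean_space \<Rightarrow> 'a \<Rightarrow> real \<Rightarrow> 'a \<Rightarrow> real" where
  "box_bump a b s x = (\<Prod>i\<in>Basis. flat_exp 0 (s * (x \<bullet> i) + - s * (a \<bullet> i)) * flat_exp 0 (- s * (x \<bullet> i) + s * (b \<bullet> i)))"

lemma box_bump_smooth: "smooth_fun (box_bump a b s)"
  unfolding box_bump_def
  by (intro smooth_funI kdiff_prod kdiff_mult kdiff_flat_exp finite_Basis)

lemma box_bump_eq_0:
  assumes "s > 0" "x \<notin> box a b"
  shows "box_bump a b s x = 0"
proof -
  obtain i where i: "i \<in> Basis" "x \<bullet> i \<le> a \<bullet> i \<or> b \<bullet> i \<le> x \<bullet> i"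
    using assms(2) by (auto simp: mem_box not_less)
  then have "flat_exp 0 (s * (x \<bullet> i) + - s * (a \<bullet> i)) * flat_exp 0 (- s * (x \<bullet> i) + s * (b \<bullet> i)) = 0"
    using assms(1) by (auto simp: flat_exp_def)
  then show ?thesis
    unfolding box_bump_def using i(1) by (auto intro!: prod_zero)
qed

lemma box_bump_test_funs:
  assumes "s > 0" "cbox a b \<subseteq> \<Omega>"
  shows "box_bump a b s \<in> test_funs \<Omega>"
proof -
  have "closure {x. box_bump a b s x \<noteq> 0} \<subseteq> cbox a b"
    using box_bump_eq_0[OF assms(1)] box_subset_cbox[of a b]
    by (intro closure_minimal) auto
  then show ?thesis
    using assms(2) box_bump_smooth[of a b s] compact_cbox[of a b] closed_closure
    unfolding test_funs_def by (auto intro: compact_closure[THEN iffD2] bounded_subset bounded_cbox closure_subset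
        simp: compact_eq_bounded_closed)
qed

lemma box_bump_bounds: "0 \<le> box_bump a b s x" "box_bump a b s x \<le> 1"
  unfolding box_bump_def using flat_exp_bounds
  by (auto intro!: prod_nonneg prod_le_1 mult_le_one)

lemma box_bump_tendsto:
  "(\<lambda>n. box_bump a b (real (Suc n)) x) \<longlonglongrightarrow> indicator (box a b) x"
proof (cases "x \<in> box a b")
  case True
  have flat: "(\<lambda>n. flat_exp 0 (real (Suc n) * t)) \<longlonglongrightarrow> 1" if "t > 0" for t
  proof -
    have "(\<lambda>n. exp (- (inverse (real (Suc n)) * inverse t))) \<longlonglongrightarrow> exp (- (0 * inverse t))"
      by (intro tendsto_intros LIMSEQ_inverse_real_of_nat)
    then show ?thesis using that by (simp add: flat_exp_def)
  qed
  have "(\<lambda>n. \<Prod>i\<in>Basis. flat_exp 0 (real (Suc n) * (x \<bullet> i - a \<bullet> i)) * flat_exp 0 (real (Suc n) * (b \<bullet> i - x \<bullet> i)))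
      \<longlonglongrightarrow> (\<Prod>i\<in>(Basis::'a set). 1 * 1)"
    using True by (intro tendsto_prod tendsto_mult flat) (auto simp: mem_box)
  then show ?thesis
    using True by (simp add: box_bump_def algebra_simps)
next
  case False
  then show ?thesis by (simp add: box_bump_eq_0)
qed

section \<open>Uniqueness of weak gradients\<close>

lemma integrable_mult_square_integrable:
  assumes "f \<in> square_integrable M" "g \<in> square_integrable M"
  shows "integrable M (\<lambda>x. f x * g x)"
proof (rule Bochner_Integration.integrable_bound)
  show "integrable M (\<lambda>x. (f x)\<^sup>2 + (g x)\<^sup>2)"
    using assms by (auto simp: square_integrable_def)
  show "(\<lambda>x. f x * g x) \<in> borel_measurable M"
    using assms by (auto simp: square_integrable_def)
  have "\<bar>a * b\<bar> \<le> a\<^sup>2 + b\<^sup>2" for a b :: real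
    using sum_squares_bound[of "\<bar>a\<bar>" "\<bar>b\<bar>"] abs_ge_zero[of "a * b"]
    unfolding abs_mult power2_abs mult.assoc by linarith
  then show "AE x in M. norm (f x * g x) \<le> norm ((f x)\<^sup>2 + (g x)\<^sup>2)"
    by simp
qed

lemma square_integrable_diff:
  assumes "f \<in> square_integrable M" "g \<in> square_integrable M"
  shows "(\<lambda>x. f x - g x) \<in> square_integrable M"
proof -
  have "(\<lambda>x. (f x - g x)\<^sup>2) = (\<lambda>x. (f x)\<^sup>2 + (g x)\<^sup>2 - 2 * (f x * g x))"
    by (auto simp: fun_eq_iff power2_eq_square algebra_simps)
  then show ?thesis
    using assms integrable_mult_square_integrable[OF assms]
    by (auto simp: square_integrable_def)
qed

lemma integrable_lebesgue_on_UNIV: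
  assumes "open \<Omega>"
  shows "integrable (lebesgue_on \<Omega>) f \<longleftrightarrow> integrable lebesgue (\<lambda>x. indicator \<Omega> x * f x :: real)"
  using assms by (subst integrable_restrict_space) auto

lemma integral_lebesgue_on_UNIV:
  assumes "open \<Omega>"
  shows "integral\<^sup>L (lebesgue_on \<Omega>) f = integral\<^sup>L lebesgue (\<lambda>x. indicator \<Omega> x * f x :: real)"
  using assms by (subst integral_restrict_space) auto

lemma borel_measurable_lebesgue_on: "f \<in> borel_measurable borel \<Longrightarrow> f \<in> borel_measurable (lebesgue_on S)"
  by (intro measurable_restrict_space1 measurable_completion) simp

lemma indicator_cbox_square_integrable:
  "open \<Omega> \<Longrightarrow> indicator (cbox a b) \<in> L2 \<Omega>"
  unfolding square_integrable_def
proof safe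
  assume o: "open \<Omega>"
  show "indicat_real (cbox a b) \<in> borel_measurable (lebesgue_on \<Omega>)"
    by (simp add: borel_measurable_lebesgue_on)
  have "integrable lebesgue (\<lambda>x. indicator (cbox a b \<inter> \<Omega>) x :: real)"
  proof (rule integrable_real_indicator)
    show "cbox a b \<inter> \<Omega> \<in> sets lebesgue" using o by auto
    have "emeasure lebesgue (cbox a b \<inter> \<Omega>) \<le> emeasure lebesgue (cbox a b)"
      by (intro emeasure_mono) auto
    also have "\<dots> < \<infinity>"
      using emeasure_lborel_cbox_finite[of a b] by simp
    finally show "emeasure lebesgue (cbox a b \<inter> \<Omega>) < \<infinity>" .
  qed
  also have "(\<lambda>x. indicator (cbox a b \<inter> \<Omega>) x :: real) = (\<lambda>x. indicator \<Omega> x * (indicator (cbox a b) x)\<^sup>2)"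
    by (auto simp: indicator_def)
  finally show "integrable (lebesgue_on \<Omega>) (\<lambda>x. (indicat_real (cbox a b) x)\<^sup>2)"
    using o by (simp add: integrable_lebesgue_on_UNIV)
qed

lemma cbox_supported_square_integrable:
  assumes o: "open \<Omega>" and f: "continuous_on UNIV f" and 0: "\<And>x. x \<notin> cbox a b \<Longrightarrow> f x = (0::real)"
  shows "f \<in> L2 \<Omega>"
proof -
  have "bounded (f ` cbox a b)"
    by (intro compact_imp_bounded compact_continuous_image continuous_on_subset[OF f] compact_cbox) auto
  then obtain B where B: "\<And>x. x \<in> cbox a b \<Longrightarrow> \<bar>f x\<bar> \<le> B"
    by (auto simp: bounded_iff)
  have m: "f \<in> borel_measurable (lebesgue_on \<Omega>)"
    by (intro borel_measurable_lebesgue_on borel_measurable_continuous_onI f)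
  have "integrable (lebesgue_on \<Omega>) (\<lambda>x. (f x)\<^sup>2)"
  proof (rule Bochner_Integration.integrable_bound)
    show "integrable (lebesgue_on \<Omega>) (\<lambda>x. B\<^sup>2 * (indicator (cbox a b) x)\<^sup>2)"
      using indicator_cbox_square_integrable[OF o, of a b] by (simp add: square_integrable_def)
    show "AE x in lebesgue_on \<Omega>. norm ((f x)\<^sup>2) \<le> norm (B\<^sup>2 * (indicator (cbox a b) x)\<^sup>2)"
    proof (rule AE_I2)
      fix x
      show "norm ((f x)\<^sup>2) \<le> norm (B\<^sup>2 * (indicator (cbox a b) x)\<^sup>2)"
        using B[of x] 0[of x] by (cases "x \<in> cbox a b") (auto simp: abs_le_square_iff[symmetric])
    qed
  qed (use m in auto)
  with m show ?thesis by (simp add: square_integrable_def)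
qed

lemma test_funs_support:
  assumes "\<phi> \<in> test_funs \<Omega>"
  obtains a where "\<And>x. x \<notin> cbox (- a) a \<Longrightarrow> \<phi> x = 0"
proof -
  have "bounded (closure {x. \<phi> x \<noteq> 0})"
    using assms by (auto simp: test_funs_def compact_imp_bounded)
  from bounded_subset_cbox_symmetric[OF this] obtain a where "closure {x. \<phi> x \<noteq> 0} \<subseteq> cbox (- a) a" .
  then show ?thesis
    using closure_subset[of "{x. \<phi> x \<noteq> 0}"] that[of a] by blast
qed

lemma test_funs_smooth: "\<phi> \<in> test_funs \<Omega> \<Longrightarrow> smooth_fun \<phi>"
  by (simp add: test_funs_def)

lemma test_funs_L2:
  assumes "open \<Omega>" "\<phi> \<in> test_funs \<Omega>"
  shows "\<phi> \<in> L2 \<Omega>"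
proof -
  obtain a where "\<And>x. x \<notin> cbox (- a) a \<Longrightarrow> \<phi> x = 0"
    using test_funs_support[OF assms(2)] by blast
  then show ?thesis
    by (rule cbox_supported_square_integrable[OF assms(1) smooth_fun_continuous[OF test_funs_smooth[OF assms(2)]]])
qed

lemma integrable_on_cbox_of_square_integrable:
  assumes "open \<Omega>" "g \<in> L2 \<Omega>"
  shows "integrable lebesgue (\<lambda>x. indicator (cbox a b) x * (indicator \<Omega> x * g x))"
proof -
  have "(\<lambda>x. indicator (cbox a b) x * (indicator \<Omega> x * g x)) = (\<lambda>x. indicator \<Omega> x * (g x * indicator (cbox a b) x))"
    by (auto simp: indicator_def)
  then show ?thesis
    using integrable_mult_square_integrable[OF assms(2) indicator_cbox_square_integrable[OF assms(1)]]
    by (simp only: integrable_lebesgue_on_UNIV[OF assms(1)])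
qed

text \<open>The bumps of the box are test functions because the closed box lies in \<Omega>.
  Dominated convergence applies with bound |g| on the closed box, integrable since g is square
  integrable and the box has finite measure. The limit lives on the open box; the faces are a null
  set.\<close>

lemma integral_cbox_eq_0:
  assumes o: "open \<Omega>" and g: "g \<in> L2 \<Omega>"
    and 0: "\<And>\<psi>. \<psi> \<in> test_funs \<Omega> \<Longrightarrow> (LINT x|lebesgue_on \<Omega>. g x * \<psi> x) = 0"
    and sub: "cbox a b \<subseteq> \<Omega>"
  shows "integral (cbox a b) (\<lambda>x. indicator \<Omega> x * g x) = 0"
proof -
  let ?M = "lebesgue_on \<Omega>"
  have gm: "g \<in> borel_measurable ?M"
    using g by (simp add: square_integrable_def)
  have bm: "box_bump a b s \<in> borel_measurable ?M" for s
    by (intro borel_measurable_lebesgue_on borel_measurable_continuous_onI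
        smooth_fun_continuous box_bump_smooth)
  have "(\<lambda>n. LINT x|?M. g x * box_bump a b (real (Suc n)) x) \<longlonglongrightarrow> (LINT x|?M. g x * indicator (box a b) x)"
  proof (rule integral_dominated_convergence[where w = "\<lambda>x. \<bar>g x * indicator (cbox a b) x\<bar>"])
    show "integrable ?M (\<lambda>x. \<bar>g x * indicator (cbox a b) x\<bar>)"
      by (intro integrable_abs integrable_mult_square_integrable g indicator_cbox_square_integrable o)
    show "AE x in ?M. (\<lambda>n. g x * box_bump a b (real (Suc n)) x) \<longlonglongrightarrow> g x * indicator (box a b) x"
      by (rule AE_I2) (rule tendsto_mult[OF tendsto_const box_bump_tendsto])
    show "AE x in ?M. norm (g x * box_bump a b (real (Suc n)) x) \<le> \<bar>g x * indicator (cbox a b) x\<bar>" for n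
    proof (rule AE_I2)
      fix x
      show "norm (g x * box_bump a b (real (Suc n)) x) \<le> \<bar>g x * indicator (cbox a b) x\<bar>"
        using box_bump_bounds[of a b "real (Suc n)" x] box_bump_eq_0[of "real (Suc n)" x a b, OF of_nat_0_less_iff[THEN iffD2, OF zero_less_Suc]]
          subsetD[OF box_subset_cbox, of x a b]
        by (cases "x \<in> cbox a b"; cases "x \<in> box a b") (simp_all add: abs_mult mult_left_le del: of_nat_Suc)
    qed
    have "indicat_real (box a b) \<in> borel_measurable ?M"
      by (simp add: borel_measurable_lebesgue_on)
    then show "(\<lambda>x. g x * indicat_real (box a b) x) \<in> borel_measurable ?M"
      using gm by simp
    show "(\<lambda>x. g x * box_bump a b (real (Suc n)) x) \<in> borel_measurable ?M" for n
      using gm bm by simp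
  qed
  then have "(LINT x|?M. g x * indicator (box a b) x) = 0"
    using 0[OF box_bump_test_funs[OF _ sub]] by (simp add: LIMSEQ_const_iff)
  also have "(LINT x|?M. g x * indicator (box a b) x) = (LINT x|?M. g x * indicator (cbox a b) x)"
  proof (rule integral_cong_AE)
    have "AE x in lebesgue. x \<notin> cbox a b - box a b"
      using negligible_frontier_interval[of a b] by (intro AE_not_in) (simp add: negligible_iff_null_sets)
    then have "AE x in lebesgue. x \<in> \<Omega> \<longrightarrow> g x * indicator (box a b) x = g x * indicator (cbox a b) x"
      by (rule eventually_mono) (use box_subset_cbox[of a b] in \<open>auto simp: indicator_def\<close>)
    then show "AE x in ?M. g x * indicator (box a b) x = g x * indicator (cbox a b) x"
      using o by (simp add: AE_restrict_space_iff)
    have "indicat_real (box a b) \<in> borel_measurable ?M" "indicat_real (cbox a b) \<in> borel_measurable ?M"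
      by (simp_all add: borel_measurable_lebesgue_on)
    then show "(\<lambda>x. g x * indicat_real (box a b) x) \<in> borel_measurable ?M"
      "(\<lambda>x. g x * indicat_real (cbox a b) x) \<in> borel_measurable ?M"
      using gm by simp_all
  qed
  also have "\<dots> = (LINT x|lebesgue. indicator (cbox a b) x * (indicator \<Omega> x * g x))"
    by (simp add: integral_lebesgue_on_UNIV[OF o] mult_ac)
  \<comment> \<open>Passage to the gauge integral, in which the differentiation theorem
    \<open>integrable_ccontinuous_explicit\<close> is phrased.\<close>
  also have "\<dots> = integral UNIV (\<lambda>x. indicator (cbox a b) x * (indicator \<Omega> x * g x))"
    by (rule integral_lebesgue[symmetric, OF integrable_on_cbox_of_square_integrable[OF o g]])
  also have "\<dots> = integral UNIV (\<lambda>x. if x \<in> cbox a b then indicator \<Omega> x * g x else 0)"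
    by (rule arg_cong[of _ _ "integral UNIV"]) (auto simp: indicator_def)
  also have "\<dots> = integral (cbox a b) (\<lambda>x. indicator \<Omega> x * g x)"
    by (rule integral_restrict_UNIV)
  finally show ?thesis by simp
qed

text \<open>At almost every point a locally integrable function is the limit of its averages over
  cubes with a corner there. At a point of \<Omega> the small cubes lie inside \<Omega>, where all
  these averages are 0. Extension by zero makes the function integrable on every box.\<close>

lemma fundamental_lemma_calculus_of_variations:
  assumes o: "open \<Omega>" and g: "g \<in> L2 \<Omega>"
    and 0: "\<And>\<psi>. \<psi> \<in> test_funs \<Omega> \<Longrightarrow> (LINT x|lebesgue_on \<Omega>. g x * \<psi> x) = 0"
  shows "AE x in lebesgue_on \<Omega>. g x = 0"
proof -
  define f where "f = (\<lambda>x. indicator \<Omega> x * g x)"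
  have "f integrable_on cbox a b" for a b
  proof -
    have "(\<lambda>x. indicator (cbox a b) x * f x) integrable_on UNIV"
      unfolding f_def by (intro integrable_on_lebesgue integrable_on_cbox_of_square_integrable o g)
    also have "(\<lambda>x. indicator (cbox a b) x * f x) = (\<lambda>x. if x \<in> cbox a b then f x else 0)"
      by (auto simp: indicator_def)
    finally show ?thesis by (simp add: integrable_restrict_UNIV)
  qed
  from integrable_ccontinuous_explicit[OF this] obtain N where N: "negligible N"
    and lim: "\<And>x e. x \<notin> N \<Longrightarrow> 0 < e \<Longrightarrow> \<exists>d>0. \<forall>h. 0 < h \<and> h < d \<longrightarrow>
        norm (integral (cbox x (x + h *\<^sub>R One)) f /\<^sub>R h ^ DIM('a) - f x) < e"
    by blast
  have zero: "f x = 0" if x: "x \<in> \<Omega>" "x \<notin> N" for x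
  proof (rule ccontr)
    assume "f x \<noteq> 0"
    then obtain d where d: "d > 0" and
      dl: "\<And>h. 0 < h \<Longrightarrow> h < d \<Longrightarrow> norm (integral (cbox x (x + h *\<^sub>R One)) f /\<^sub>R h ^ DIM('a) - f x) < \<bar>f x\<bar>"
      using lim[OF x(2), of "\<bar>f x\<bar>"] by auto
    obtain r where r: "r > 0" "cball x r \<subseteq> \<Omega>"
      using o x(1) open_contains_cball by blast
    \<comment> \<open>The bound \<open>d / 2\<close> keeps the average close to \<open>f x\<close>.
      Dividing \<open>r\<close> by the dimension keeps the cube in the ball: each coordinate moves
      by at most \<open>h\<close>, and the norm is at most the sum of the coordinates.\<close>
    define h where "h = min (d / 2) (r / real DIM('a))"
    have h: "0 < h" "h < d" "h * real DIM('a) \<le> r"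
      using d r(1) by (auto simp: h_def min_def field_simps)
    have "cbox x (x + h *\<^sub>R One) \<subseteq> cball x r"
    proof
      fix y assume y: "y \<in> cbox x (x + h *\<^sub>R One)"
      have "norm (y - x) \<le> (\<Sum>i\<in>Basis. \<bar>(y - x) \<bullet> i\<bar>)"
        by (rule norm_le_l1)
      also have "\<dots> \<le> (\<Sum>i\<in>(Basis::'a set). h)"
        using y by (intro sum_mono) (auto simp: mem_box algebra_simps)
      finally show "y \<in> cball x r"
        using h(3) by (simp add: dist_norm norm_minus_commute mult.commute)
    qed
    then have "integral (cbox x (x + h *\<^sub>R One)) f = 0"
      unfolding f_def using r(2) by (intro integral_cbox_eq_0[OF o g 0]) auto
    with dl[OF h(1,2)] show False by simp
  qed
  have "AE x in lebesgue. x \<notin> N"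
    using N by (auto simp: negligible_iff_null_sets intro: AE_not_in)
  then have "AE x in lebesgue. x \<in> \<Omega> \<longrightarrow> g x = 0"
    by (rule eventually_mono) (use zero in \<open>auto simp: f_def\<close>)
  then show ?thesis
    using o by (simp add: AE_restrict_space_iff)
qed

lemma weak_gradient_unique:
  assumes o: "open \<Omega>" and "is_weak_gradient \<Omega> u g" "is_weak_gradient \<Omega> u h"
  shows "AE x in lebesgue_on \<Omega>. g x = h x"
proof -
  have "AE x in lebesgue_on \<Omega>. g x \<bullet> i - h x \<bullet> i = 0" if i: "i \<in> Basis" for i
  proof (rule fundamental_lemma_calculus_of_variations[OF o])
    have gh: "(\<lambda>x. g x \<bullet> i) \<in> L2 \<Omega>" "(\<lambda>x. h x \<bullet> i) \<in> L2 \<Omega>"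
      using assms i by (auto simp: is_weak_gradient_def)
    then show "(\<lambda>x. g x \<bullet> i - h x \<bullet> i) \<in> L2 \<Omega>"
      by (rule square_integrable_diff)
    fix \<psi> assume psi: "\<psi> \<in> test_funs \<Omega>"
    then have "(LINT x|lebesgue_on \<Omega>. (g x \<bullet> i) * \<psi> x) = (LINT x|lebesgue_on \<Omega>. (h x \<bullet> i) * \<psi> x)"
      using assms i by (simp add: is_weak_gradient_def distr_eq_def regular_distr_def)
    moreover have "integrable (lebesgue_on \<Omega>) (\<lambda>x. (g x \<bullet> i) * \<psi> x)" "integrable (lebesgue_on \<Omega>) (\<lambda>x. (h x \<bullet> i) * \<psi> x)"
      by (intro integrable_mult_square_integrable gh test_funs_L2[OF o psi])+
    ultimately show "(LINT x|lebesgue_on \<Omega>. (g x \<bullet> i - h x \<bullet> i) * \<psi> x) = 0"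
      by (simp add: left_diff_distrib)
  qed
  then have "AE x in lebesgue_on \<Omega>. \<forall>i\<in>Basis. g x \<bullet> i - h x \<bullet> i = 0"
    by (intro AE_finite_allI) auto
  then show ?thesis
    by (rule eventually_mono) (auto intro: euclidean_eqI)
qed

section \<open>Test functions in Sobolev spaces\<close>

lemma test_funs_eq_0: "\<phi> \<in> test_funs \<Omega> \<Longrightarrow> x \<notin> \<Omega> \<Longrightarrow> \<phi> x = 0"
  using closure_subset[of "{x. \<phi> x \<noteq> 0}"] by (auto simp: test_funs_def)

lemma test_funsI:
  assumes "smooth_fun \<psi>" "\<phi> \<in> test_funs \<Omega>" "{x. \<psi> x \<noteq> 0} \<subseteq> closure {x. \<phi> x \<noteq> 0}"
  shows "\<psi> \<in> test_funs \<Omega>"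
proof -
  have sub: "closure {x. \<psi> x \<noteq> 0} \<subseteq> closure {x. \<phi> x \<noteq> 0}"
    using assms(3) by (intro closure_minimal) auto
  moreover have "compact (closure {x. \<psi> x \<noteq> 0})"
    using compact_Int_closed[of "closure {x. \<phi> x \<noteq> 0}" "closure {x. \<psi> x \<noteq> 0}"] assms(2) sub
    by (auto simp: test_funs_def Int_absorb1)
  ultimately show ?thesis
    using assms(1,2) by (auto simp: test_funs_def)
qed

lemma smooth_fun_kdiff: "smooth_fun f \<Longrightarrow> kdiff n f"
  by (induction n arbitrary: f) (auto simp: differentiable_on_def smooth_fun_partial
      intro: differentiable_at_withinI smooth_fun_differentiable)

lemma test_funs_mult:
  assumes "\<phi> \<in> test_funs \<Omega>" "\<psi> \<in> test_funs \<Omega>"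
  shows "(\<lambda>x. \<phi> x * \<psi> x) \<in> test_funs \<Omega>"
proof (rule test_funsI[OF _ assms(1)])
  show "smooth_fun (\<lambda>x. \<phi> x * \<psi> x)"
    by (rule smooth_funI) (rule kdiff_mult; rule smooth_fun_kdiff; rule test_funs_smooth; fact)
  show "{x. \<phi> x * \<psi> x \<noteq> 0} \<subseteq> closure {x. \<phi> x \<noteq> 0}"
    using closure_subset[of "{x. \<phi> x \<noteq> 0}"] by auto
qed

lemma test_funs_partial:
  assumes "\<phi> \<in> test_funs \<Omega>" "i \<in> Basis"
  shows "partial_deriv i \<phi> \<in> test_funs \<Omega>"
proof (rule test_funsI[OF _ assms(1)])
  show "smooth_fun (partial_deriv i \<phi>)"
    using assms by (intro smooth_fun_partial test_funs_smooth)
  show "{x. partial_deriv i \<phi> x \<noteq> 0} \<subseteq> closure {x. \<phi> x \<noteq> 0}"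
  proof (rule ccontr)
    assume "\<not> {x. partial_deriv i \<phi> x \<noteq> 0} \<subseteq> closure {x. \<phi> x \<noteq> 0}"
    then obtain x where x: "partial_deriv i \<phi> x \<noteq> 0" "x \<in> - closure {x. \<phi> x \<noteq> 0}"
      by auto
    \<comment> \<open>The complement of the closed support is open, so \<phi> is zero on a whole
      neighbourhood of \<open>x\<close>.\<close>
    have "(\<phi> has_derivative (\<lambda>h. 0)) (at x)"
      by (rule has_derivative_transform_within_open[OF has_derivative_const[of 0] _ x(2)])
        (use closure_subset[of "{x. \<phi> x \<noteq> 0}"] in auto)
    with x(1) show False
      by (simp add: partial_derivI)
  qed
qed

lemma zero_test_funs: "(\<lambda>x. 0) \<in> test_funs \<Omega>"
  by (auto simp: test_funs_def intro: smooth_funI kdiff_const)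

lemma test_funs_borel: "\<phi> \<in> test_funs \<Omega> \<Longrightarrow> \<phi> \<in> borel_measurable borel"
  by (intro borel_measurable_continuous_onI smooth_fun_continuous test_funs_smooth)

lemma test_funs_bounded:
  assumes "\<phi> \<in> test_funs \<Omega>"
  obtains B where "\<And>x. \<bar>\<phi> x\<bar> \<le> B"
proof -
  obtain a where a: "\<And>x. x \<notin> cbox (- a) a \<Longrightarrow> \<phi> x = 0"
    using test_funs_support[OF assms] by blast
  have "bounded (\<phi> ` cbox (- a) a)"
    by (intro compact_imp_bounded compact_continuous_image compact_cbox
        continuous_on_subset[OF smooth_fun_continuous[OF test_funs_smooth[OF assms]]]) auto
  then obtain B where B: "\<And>x. x \<in> cbox (- a) a \<Longrightarrow> \<bar>\<phi> x\<bar> \<le> B"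
    by (auto simp: bounded_iff)
  \<comment> \<open>If the box is empty, \<open>B\<close> is unconstrained and may be
    negative.\<close>
  have "\<bar>\<phi> x\<bar> \<le> max 0 B" for x
    using a[of x] B[of x] by (cases "x \<in> cbox (- a) a") auto
  then show ?thesis using that by blast
qed

lemma test_funs_integrable:
  assumes "\<phi> \<in> test_funs \<Omega>"
  shows "integrable lborel \<phi>"
proof -
  obtain a where a: "\<And>x. x \<notin> cbox (- a) a \<Longrightarrow> \<phi> x = 0"
    using test_funs_support[OF assms] by blast
  have "integrable lborel (\<lambda>x. indicator (cbox (- a) a) x *\<^sub>R \<phi> x)"
    by (intro borel_integrable_compact compact_cbox
        continuous_on_subset[OF smooth_fun_continuous[OF test_funs_smooth[OF assms]]]) auto
  also have "(\<lambda>x. indicator (cbox (- a) a) x *\<^sub>R \<phi> x) = \<phi>"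
    using a by (auto simp: indicator_def fun_eq_iff)
  finally show ?thesis .
qed

text \<open>\<phi> vanishes off \<Omega> and is Borel, so neither the restriction nor the completion
  affects its integral. On \<open>lborel\<close> translation invariance can be applied.\<close>

lemma integral_test_fun:
  assumes "open \<Omega>" "\<phi> \<in> test_funs \<Omega>"
  shows "(LINT x|lebesgue_on \<Omega>. \<phi> x) = (LINT x|lborel. \<phi> x)"
proof -
  have "(\<lambda>x. indicator \<Omega> x * \<phi> x) = \<phi>"
    using test_funs_eq_0[OF assms(2)] by (auto simp: indicator_def fun_eq_iff)
  then show ?thesis
    using test_funs_borel[OF assms(2)]
    by (simp add: integral_lebesgue_on_UNIV[OF assms(1)] integral_completion)
qed

section \<open>Integration by parts for test functions\<close>

lemma test_funs_line_deriv:
  assumes "\<phi> \<in> test_funs \<Omega>"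
  shows "((\<lambda>s. \<phi> (x + s *\<^sub>R i)) has_real_derivative partial_deriv i \<phi> (x + s *\<^sub>R i)) (at s)"
proof -
  have D: "(\<phi> has_derivative frechet_derivative \<phi> (at (x + s *\<^sub>R i))) (at (x + s *\<^sub>R i))"
    using smooth_fun_differentiable[OF test_funs_smooth[OF assms]] frechet_derivative_works by blast
  interpret linear "frechet_derivative \<phi> (at (x + s *\<^sub>R i))"
    using D by (rule has_derivative_linear)
  have "((\<lambda>s. \<phi> (x + s *\<^sub>R i)) has_derivative (\<lambda>h. frechet_derivative \<phi> (at (x + s *\<^sub>R i)) (h *\<^sub>R i))) (at s)"
    by (rule has_derivative_compose[where f = "\<lambda>s. x + s *\<^sub>R i" and g = \<phi>, OF _ D]) (auto intro!: derivative_eq_intros)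
  then show ?thesis
    by (simp add: has_field_derivative_def scale partial_deriv_def mult_commute_abs)
qed

lemma integral_partial_deriv_eq_0:
  fixes \<phi> :: "'a::euclidean_space \<Rightarrow> real"
  assumes phi: "\<phi> \<in> test_funs \<Omega>" and i: "i \<in> Basis"
  shows "(LINT x|lborel. partial_deriv i \<phi> x) = 0"
proof -
  txt \<open>Difference quotients integrate to zero by translation invariance.\<close>
  define D where "D n x = (\<phi> (inverse (real (Suc n)) *\<^sub>R i + x) - \<phi> x) / inverse (real (Suc n))" for n x
  obtain a where a: "\<And>x. x \<notin> cbox (- a) a \<Longrightarrow> \<phi> x = 0"
    using test_funs_support[OF phi] by blast
  obtain B where B: "\<And>x. \<bar>partial_deriv i \<phi> x\<bar> \<le> B"
    using test_funs_bounded[OF test_funs_partial[OF phi i]] by metis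
  have "(\<lambda>n. LINT x|lborel. D n x) \<longlonglongrightarrow> (LINT x|lborel. partial_deriv i \<phi> x)"
  \<comment> \<open>The mean value theorem bounds the quotient by \<open>B\<close>. The support box
    is enlarged by \<open>One\<close> because the increments are at most 1: outside the larger box,
    both the point and its translate miss the support.\<close>
  proof (rule integral_dominated_convergence[where w = "\<lambda>x. B * indicator (cbox (- a - One) (a + One)) x"])
    show "integrable lborel (\<lambda>x. B * indicator (cbox (- a - One) (a + One)) x)"
      using emeasure_lborel_cbox_finite by (intro integrable_mult_right integrable_real_indicator) auto
    show "partial_deriv i \<phi> \<in> borel_measurable lborel"
      using test_funs_borel[OF test_funs_partial[OF phi i]] by simp
    show "D n \<in> borel_measurable lborel" for n
      using test_funs_borel[OF phi] unfolding D_def by simp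
    show "AE x in lborel. (\<lambda>n. D n x) \<longlonglongrightarrow> partial_deriv i \<phi> x"
    proof (rule AE_I2)
      fix x
      have "((\<lambda>h. (\<phi> (x + (0 + h) *\<^sub>R i) - \<phi> (x + 0 *\<^sub>R i)) / h) \<longlongrightarrow> partial_deriv i \<phi> (x + 0 *\<^sub>R i)) (at 0)"
        using test_funs_line_deriv[OF phi, of x i 0] by (simp only: DERIV_def)
      moreover have "filterlim (\<lambda>n. inverse (real (Suc n))) (at 0) sequentially"
        using LIMSEQ_inverse_real_of_nat by (auto simp: filterlim_at)
      ultimately show "(\<lambda>n. D n x) \<longlonglongrightarrow> partial_deriv i \<phi> x"
        unfolding D_def by (drule_tac filterlim_compose) (auto simp: add.commute)
    qed
    show "AE x in lborel. norm (D n x) \<le> B * indicator (cbox (- a - One) (a + One)) x" for n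
    proof (rule AE_I2)
      fix x
      define h where "h = inverse (real (Suc n))"
      have h: "0 < h" "h \<le> 1"
        by (auto simp: h_def inverse_le_1_iff)
      show "norm (D n x) \<le> B * indicator (cbox (- a - One) (a + One)) x"
      proof (cases "x \<in> cbox (- a - One) (a + One)")
        case True
        obtain z where "\<phi> (x + h *\<^sub>R i) - \<phi> (x + 0 *\<^sub>R i) = (h - 0) * partial_deriv i \<phi> (x + z *\<^sub>R i)"
          using MVT2[OF h(1), of "\<lambda>s. \<phi> (x + s *\<^sub>R i)" "\<lambda>s. partial_deriv i \<phi> (x + s *\<^sub>R i)"] test_funs_line_deriv[OF phi] by blast
        moreover have "D n x = (\<phi> (x + h *\<^sub>R i) - \<phi> x) / h"
          by (simp only: D_def h_def add.commute)
        ultimately have "D n x = partial_deriv i \<phi> (x + z *\<^sub>R i)"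
          using h(1) by simp
        with True B show ?thesis by simp
      next
        case False
        have "x \<notin> cbox (- a) a"
          using False by (force simp: mem_box algebra_simps)
        moreover have "h *\<^sub>R i + x \<notin> cbox (- a) a"
        proof
          assume m: "h *\<^sub>R i + x \<in> cbox (- a) a"
          have "\<bar>(h *\<^sub>R i) \<bullet> j\<bar> \<le> 1" if "j \<in> Basis" for j
            using h i that by (auto simp: inner_Basis)
          with m False show False
            by (force simp: mem_box algebra_simps abs_le_iff)
        qed
        ultimately show ?thesis
          using False a by (simp add: D_def h_def)
      qed
    qed
  qed
  moreover have "(LINT x|lborel. D n x) = 0" for n
  proof -
    let ?c = "inverse (real (Suc n)) *\<^sub>R i"
    have I: "integrable (distr lborel borel ((+) ?c)) \<phi>"
      unfolding lborel_distr_plus by (rule test_funs_integrable[OF phi])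
    then have I2: "integrable lborel (\<lambda>x. \<phi> (?c + x))"
      using test_funs_borel[OF phi] by (subst (asm) integrable_distr_eq) auto
    have "(LINT x|lborel. \<phi> x) = (LINT x|distr lborel borel ((+) ?c). \<phi> x)"
      unfolding lborel_distr_plus ..
    also have "\<dots> = (LINT x|lborel. \<phi> (?c + x))"
      using test_funs_borel[OF phi] by (intro integral_distr) auto
    finally show ?thesis
      unfolding D_def using I2 test_funs_integrable[OF phi] by simp
  qed
  ultimately show ?thesis
    by (simp add: LIMSEQ_const_iff)
qed

definition grad :: "('a::euclidean_space \<Rightarrow> real) \<Rightarrow> 'a \<Rightarrow> 'a" where
  "grad \<phi> x = (\<Sum>i\<in>Basis. partial_deriv i \<phi> x *\<^sub>R i)"

lemma grad_inner: "i \<in> Basis \<Longrightarrow> grad \<phi> x \<bullet> i = partial_deriv i \<phi> x"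
  by (simp add: grad_def)

text \<open>Integration by parts: the derivative of the product of \<phi> and \<psi> integrates to
  zero, and the product rule splits that integral in two.\<close>

lemma is_weak_gradient_test_fun:
  assumes o: "open \<Omega>" and phi: "\<phi> \<in> test_funs \<Omega>"
  shows "is_weak_gradient \<Omega> \<phi> (grad \<phi>)"
  unfolding is_weak_gradient_def distr_eq_def
proof (intro ballI conjI)
  fix i :: 'a assume i: "i \<in> Basis"
  show "(\<lambda>x. grad \<phi> x \<bullet> i) \<in> L2 \<Omega>"
    using test_funs_L2[OF o test_funs_partial[OF phi i]] by (simp add: grad_inner[OF i])
  fix \<psi> assume psi: "\<psi> \<in> test_funs \<Omega>"
  note L2 = test_funs_L2[OF o phi] test_funs_L2[OF o psi]
    test_funs_L2[OF o test_funs_partial[OF phi i]] test_funs_L2[OF o test_funs_partial[OF psi i]]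
  have "0 = (LINT x|lebesgue_on \<Omega>. partial_deriv i (\<lambda>x. \<phi> x * \<psi> x) x)"
    using integral_test_fun[OF o test_funs_partial[OF test_funs_mult[OF phi psi] i]]
      integral_partial_deriv_eq_0[OF test_funs_mult[OF phi psi] i] by simp
  also have "\<dots> = (LINT x|lebesgue_on \<Omega>. \<phi> x * partial_deriv i \<psi> x + partial_deriv i \<phi> x * \<psi> x)"
    using smooth_fun_kdiff[OF test_funs_smooth[OF phi], of 1] smooth_fun_kdiff[OF test_funs_smooth[OF psi], of 1]
    by (simp add: partial_deriv_mult)
  also have "\<dots> = (LINT x|lebesgue_on \<Omega>. \<phi> x * partial_deriv i \<psi> x) + (LINT x|lebesgue_on \<Omega>. partial_deriv i \<phi> x * \<psi> x)"
    by (intro Bochner_Integration.integral_add integrable_mult_square_integrable L2)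
  finally show "regular_distr \<Omega> (\<lambda>x. grad \<phi> x \<bullet> i) \<psi> = distr_partial i (regular_distr \<Omega> \<phi>) \<psi>"
    by (simp add: regular_distr_def distr_partial_def grad_inner[OF i])
qed

lemma test_funs_H1: "open \<Omega> \<Longrightarrow> \<phi> \<in> test_funs \<Omega> \<Longrightarrow> \<phi> \<in> H1 \<Omega>"
  unfolding H1_def using is_weak_gradient_test_fun test_funs_L2 by blast

lemma is_weak_gradient_weak_grad: "u \<in> H1 \<Omega> \<Longrightarrow> is_weak_gradient \<Omega> u (weak_grad \<Omega> u)"
  using someI_ex[of "is_weak_gradient \<Omega> u"] by (simp add: H1_def weak_grad_def)

lemma weak_grad_test_fun:
  assumes "open \<Omega>" "\<phi> \<in> test_funs \<Omega>"
  shows "AE x in lebesgue_on \<Omega>. weak_grad \<Omega> \<phi> x = grad \<phi> x"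
  using weak_gradient_unique is_weak_gradient_weak_grad test_funs_H1 is_weak_gradient_test_fun assms
  by blast

text \<open>\<open>weak_grad\<close> of the zero function is an arbitrary choice, so it is known to
  vanish only almost everywhere, through uniqueness.\<close>

lemma dirichlet1_zero:
  assumes "open \<Omega>"
  shows "dirichlet1 \<Omega> (\<lambda>x. 0) (\<lambda>x. 0) = 0"
proof -
  have "grad (\<lambda>x. 0) = (\<lambda>x::'a. 0)"
    by (simp add: grad_def partial_derivI[OF has_derivative_const] fun_eq_iff)
  then have "dirichlet \<Omega> (\<lambda>x. 0) (\<lambda>x. 0) = 0"
    unfolding dirichlet_def using weak_grad_test_fun[OF assms zero_test_funs]
    by (intro integral_eq_zero_AE) (auto elim: eventually_mono)
  then show ?thesis
    by (simp add: dirichlet1_def L2_inner_def)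
qed

lemma test_funs_Cc_closure:
  assumes "\<phi> \<in> test_funs \<Omega>"
  shows "\<phi> \<in> Cc_closure \<Omega>"
proof -
  let ?K = "closure {x. \<phi> x \<noteq> 0}"
  have "compact ?K" "?K \<subseteq> closure \<Omega>" "\<forall>x\<in>closure \<Omega> - ?K. \<phi> x = 0"
    using assms closure_subset[of \<Omega>] closure_subset[of "{x. \<phi> x \<noteq> 0}"]
    by (auto simp: test_funs_def)
  moreover have "continuous_on (closure \<Omega>) \<phi>"
    by (rule continuous_on_subset[OF smooth_fun_continuous[OF test_funs_smooth[OF assms]]]) simp
  ultimately show ?thesis
    unfolding Cc_closure_def by blast
qed

lemma test_funs_H1_tilde:
  assumes "open \<Omega>" "\<phi> \<in> test_funs \<Omega>"
  shows "\<phi> \<in> H1_tilde \<Omega>"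
  unfolding H1_tilde_def
proof (intro CollectI conjI exI[of _ "\<lambda>_. \<phi>"] allI IntI)
  show "(\<lambda>n. dirichlet1 \<Omega> (\<lambda>x. \<phi> x - \<phi> x) (\<lambda>x. \<phi> x - \<phi> x)) \<longlonglongrightarrow> 0"
    by (simp add: dirichlet1_zero[OF assms(1)])
qed (rule test_funs_H1[OF assms] test_funs_Cc_closure[OF assms(2)])+

text \<open>Once the chosen gradient of \<phi> is replaced by the classical one, each coordinate
  pairs the weak gradient of \<open>u\<close> with \<open>partial_deriv i \<phi>\<close>, again a
  test function, so the defining identity of the weak gradient applies to it.\<close>

lemma dirichlet_test_fun:
  assumes o: "open \<Omega>" and u: "u \<in> H1 \<Omega>" and phi: "\<phi> \<in> test_funs \<Omega>"
  shows "dirichlet \<Omega> u \<phi> = - distr_laplacian (regular_distr \<Omega> u) \<phi>"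
proof -
  let ?G = "weak_grad \<Omega> u" and ?M = "lebesgue_on \<Omega>"
  have G: "\<And>i. i \<in> Basis \<Longrightarrow> (\<lambda>x. ?G x \<bullet> i) \<in> L2 \<Omega>"
    "\<And>i \<psi>. i \<in> Basis \<Longrightarrow> \<psi> \<in> test_funs \<Omega> \<Longrightarrow>
      regular_distr \<Omega> (\<lambda>x. ?G x \<bullet> i) \<psi> = distr_partial i (regular_distr \<Omega> u) \<psi>"
    using is_weak_gradient_weak_grad[OF u] unfolding is_weak_gradient_def distr_eq_def by blast+
  have H: "\<And>i. i \<in> Basis \<Longrightarrow> (\<lambda>x. weak_grad \<Omega> \<phi> x \<bullet> i) \<in> L2 \<Omega>"
    using is_weak_gradient_weak_grad[OF test_funs_H1[OF o phi]] unfolding is_weak_gradient_def by blast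
  have "dirichlet \<Omega> u \<phi> = (LINT x|?M. (\<Sum>i\<in>Basis. (?G x \<bullet> i) * (weak_grad \<Omega> \<phi> x \<bullet> i)))"
    unfolding dirichlet_def by (rule Bochner_Integration.integral_cong[OF refl euclidean_inner])
  also have "\<dots> = (\<Sum>i\<in>Basis. (LINT x|?M. (?G x \<bullet> i) * (weak_grad \<Omega> \<phi> x \<bullet> i)))"
    by (intro Bochner_Integration.integral_sum integrable_mult_square_integrable G H)
  also have "\<dots> = (\<Sum>i\<in>Basis. regular_distr \<Omega> (\<lambda>x. ?G x \<bullet> i) (partial_deriv i \<phi>))"
  proof (rule sum.cong[OF refl])
    fix i :: 'a assume i: "i \<in> Basis"
    have "AE x in ?M. (?G x \<bullet> i) * (weak_grad \<Omega> \<phi> x \<bullet> i) = (?G x \<bullet> i) * partial_deriv i \<phi> x"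
      using weak_grad_test_fun[OF o phi] by (rule eventually_mono) (simp add: grad_inner[OF i])
    moreover note G(1)[OF i] H[OF i] test_funs_L2[OF o test_funs_partial[OF phi i]]
    ultimately show "(LINT x|?M. (?G x \<bullet> i) * (weak_grad \<Omega> \<phi> x \<bullet> i)) = regular_distr \<Omega> (\<lambda>x. ?G x \<bullet> i) (partial_deriv i \<phi>)"
      unfolding regular_distr_def by (intro integral_cong_AE) (auto simp: square_integrable_def)
  qed
  also have "\<dots> = (\<Sum>i\<in>Basis. distr_partial i (regular_distr \<Omega> u) (partial_deriv i \<phi>))"
    by (intro sum.cong refl G(2) test_funs_partial phi)
  also have "\<dots> = - distr_laplacian (regular_distr \<Omega> u) \<phi>"
    \<comment> \<open>Only the outer of the two distributional derivatives is unfolded; it moves one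
      derivative onto \<phi> and contributes the minus sign.\<close>
    by (simp add: distr_laplacian_def distr_partial_def[of _ "distr_partial _ _"] sum_negf)
  finally show ?thesis .
qed

section \<open>Capacity and boundary integrals\<close>

lemma rel_cap_lessE:
  assumes "rel_cap \<Omega> A < e"
  obtains B where "openin (top_of_set (closure \<Omega>)) B" "A \<subseteq> B" "cap_open \<Omega> B < e"
  using assms unfolding rel_cap_def by (auto simp: INF_less_iff)

lemma rel_cap_le: "openin (top_of_set (closure \<Omega>)) B \<Longrightarrow> A \<subseteq> B \<Longrightarrow> rel_cap \<Omega> A \<le> cap_open \<Omega> B"
  unfolding rel_cap_def by (intro INF_lower) auto

lemma rel_cap_mono: "A \<subseteq> B \<Longrightarrow> rel_cap \<Omega> A \<le> rel_cap \<Omega> B"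
  unfolding rel_cap_def by (intro INF_superset_mono) auto

lemma rel_cap_empty:
  assumes "open \<Omega>"
  shows "rel_cap \<Omega> {} = 0"
proof -
  have "cap_open \<Omega> {} \<le> ennreal (dirichlet1 \<Omega> (\<lambda>x. 0) (\<lambda>x. 0))"
    unfolding cap_open_def
    by (intro INF_lower) (auto intro: test_funs_H1_tilde assms zero_test_funs)
  then have "cap_open \<Omega> {} = 0"
    by (simp add: dirichlet1_zero[OF assms])
  then show ?thesis
    using rel_cap_le[of \<Omega> "{}" "{}"] by simp
qed

text \<open>Inclusion up to a null set suffices: every function admissible for \<open>B\<close> is
  admissible for \<open>A\<close>, the constraint being imposed almost everywhere.\<close>

lemma cap_open_mono_AE:
  assumes "AE x in lebesgue_on \<Omega>. x \<in> A \<longrightarrow> x \<in> B"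
  shows "cap_open \<Omega> A \<le> cap_open \<Omega> B"
  unfolding cap_open_def
proof (intro INF_superset_mono subsetI order_refl)
  fix u assume u: "u \<in> {u \<in> H1_tilde \<Omega>. AE x in lebesgue_on \<Omega>. x \<in> B \<longrightarrow> 1 \<le> u x}"
  then have "AE x in lebesgue_on \<Omega>. x \<in> B \<longrightarrow> 1 \<le> u x" by simp
  with assms have "AE x in lebesgue_on \<Omega>. x \<in> A \<longrightarrow> 1 \<le> u x"
    by eventually_elim auto
  with u show "u \<in> {u \<in> H1_tilde \<Omega>. AE x in lebesgue_on \<Omega>. x \<in> A \<longrightarrow> 1 \<le> u x}" by simp
qed

lemma rel_cap_AE_eq_continuous:
  assumes f: "quasi_continuous \<Omega> f" and g: "continuous_on (closure \<Omega>) g"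
    and ae: "AE x in lebesgue_on \<Omega>. f x = g x"
  shows "rel_cap \<Omega> {x \<in> closure \<Omega>. f x \<noteq> g x} = 0"
proof (rule ccontr)
  let ?T = "top_of_set (closure \<Omega>)" and ?A = "{x \<in> closure \<Omega>. f x \<noteq> g x}"
  assume "rel_cap \<Omega> ?A \<noteq> 0"
  then have pos: "rel_cap \<Omega> ?A > 0"
    by (simp add: zero_less_iff_neq_zero)
  \<comment> \<open>The capacity of the set itself serves as epsilon. A single exceptional set of
    strictly smaller capacity then gives the contradiction, with no appeal to subadditivity.\<close>
  then obtain G where G: "rel_cap \<Omega> G < rel_cap \<Omega> ?A" "continuous_on (closure \<Omega> - G) f"
    using f unfolding quasi_continuous_def by blast
  from rel_cap_lessE[OF G(1)] obtain B where
    B: "openin ?T B" "G \<subseteq> B" "cap_open \<Omega> B < rel_cap \<Omega> ?A" .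
  txt \<open>Adding the \<open>m\<close>-null set \<open>{f \<noteq> g}\<close> to \<open>B\<close> keeps it relatively open and does not change its
    capacity, because admissible functions are constrained only almost everywhere.\<close>
  let ?C = "closure \<Omega> - B"
  have "continuous_on ?C (\<lambda>x. f x - g x)"
    using G(2) g B(2) by (intro continuous_on_diff) (auto elim: continuous_on_subset)
  from continuous_openin_preimage_gen[OF this, of "- {0}"]
  have "openin (top_of_set ?C) {x \<in> ?C. f x \<noteq> g x}"
    by (simp add: vimage_def Int_def open_Compl)
  then obtain O' where O': "open O'" "{x \<in> ?C. f x \<noteq> g x} = ?C \<inter> O'"
    by (auto simp: openin_open)
  have "B \<subseteq> closure \<Omega>"
    using openin_subset[OF B(1)] by simp
  \<comment> \<open>Outside \<open>B\<close> the set \<open>?A\<close> is open only relative to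
    \<open>?C\<close>. Any further points of \<open>O'\<close> in the closure lie in
    \<open>B\<close>, so the union with \<open>B\<close> is relatively open in the closure.\<close>
  then have "B \<union> ?A = B \<union> (closure \<Omega> \<inter> O')"
    using O'(2) by blast
  then have "openin ?T (B \<union> ?A)"
    using B(1) O'(1) by auto
  then have "rel_cap \<Omega> ?A \<le> cap_open \<Omega> (B \<union> ?A)"
    by (rule rel_cap_le) auto
  also have "\<dots> \<le> cap_open \<Omega> B"
    using ae by (intro cap_open_mono_AE) (auto elim: eventually_mono)
  finally show False
    using B(3) by simp
qed

text \<open>Smooth measures are tested only on measurable sets, whereas the exceptional set of a
  chosen representative need not be Borel. Outer regularity is built into the capacity, so an
  intersection of countably many relatively open covers does the job.\<close>

lemma rel_cap_null_borel_cover: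
  fixes A :: "'a::euclidean_space set"
  assumes "rel_cap \<Omega> A = 0"
  obtains N where "N \<in> sets borel" "A \<subseteq> N" "rel_cap \<Omega> N = 0"
proof -
  have "\<exists>B. openin (top_of_set (closure \<Omega>)) B \<and> A \<subseteq> B \<and> cap_open \<Omega> B < ennreal (inverse (real (Suc n)))" for n
  proof -
    have "rel_cap \<Omega> A < ennreal (inverse (real (Suc n)))"
      using assms by simp
    then show ?thesis
      by (elim rel_cap_lessE) blast
  qed
  then obtain B where B: "\<And>n. openin (top_of_set (closure \<Omega>)) (B n)" "\<And>n. A \<subseteq> B n"
    "\<And>n. cap_open \<Omega> (B n) < ennreal (inverse (real (Suc n)))"
    by metis
  have "B n \<in> sets borel" for n
    using B(1)[of n] by (auto simp: openin_open)
  then have "(\<Inter>n. B n) \<in> sets borel"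
    by (intro sets.countable_INT) auto
  moreover have "rel_cap \<Omega> (\<Inter>n. B n) = 0"
  proof -
    have "rel_cap \<Omega> (\<Inter>n. B n) \<le> 0 + ennreal e" if e: "e > 0" for e
    proof -
      obtain n where "inverse (real (Suc n)) < e"
        using reals_Archimedean[OF e] by blast
      then have "cap_open \<Omega> (B n) \<le> ennreal e"
        using B(3)[of n] by (meson ennreal_leI less_imp_le order_trans)
      moreover have "rel_cap \<Omega> (\<Inter>n. B n) \<le> cap_open \<Omega> (B n)"
        by (rule rel_cap_le[OF B(1)]) auto
      ultimately show ?thesis by simp
    qed
    then have "rel_cap \<Omega> (\<Inter>n. B n) \<le> 0"
      by (rule ennreal_le_epsilon)
    then show ?thesis by simp
  qed
  ultimately show ?thesis
    using B(2) that by blast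
qed

lemma space_smooth_measure:
  assumes "smooth_measure \<Omega> \<mu>"
  shows "space \<mu> = frontier \<Omega>"
proof -
  have "sets \<mu> = sets (restrict_space borel (frontier \<Omega>))"
    using assms by (simp add: smooth_measure_def boundary_measure_def)
  from sets_eq_imp_space_eq[OF this] show ?thesis
    by (simp add: space_restrict_space)
qed

lemma smooth_measure_AE:
  assumes mu: "smooth_measure \<Omega> \<mu>" and A: "rel_cap \<Omega> A = 0"
  shows "AE x in \<mu>. x \<notin> A"
proof -
  from rel_cap_null_borel_cover[OF A] obtain N where
    N: "N \<in> sets borel" "A \<subseteq> N" "rel_cap \<Omega> N = 0" .
  have "N \<inter> frontier \<Omega> \<in> sets \<mu>"
    using mu N(1) by (auto simp: smooth_measure_def boundary_measure_def sets_restrict_space)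
  moreover have "rel_cap \<Omega> (N \<inter> frontier \<Omega>) = 0"
    using rel_cap_mono[of "N \<inter> frontier \<Omega>" N \<Omega>] N(3) by simp
  ultimately have "N \<inter> frontier \<Omega> \<in> null_sets \<mu>"
    using mu by (auto simp: smooth_measure_def)
  then have "AE x in \<mu>. x \<notin> N \<inter> frontier \<Omega>"
    by (rule AE_not_in)
  moreover have "space \<mu> = frontier \<Omega>"
    by (rule space_smooth_measure[OF mu])
  ultimately show ?thesis
    using AE_space[of \<mu>] N(2) by (auto elim: eventually_elim2)
qed

section \<open>Functions vanishing almost everywhere and the total variation\<close>

lemma measurable_completion_AE_0:
  fixes f :: "'a \<Rightarrow> real"
  assumes "AE x in M. f x = 0"
  shows "f \<in> borel_measurable (completion M)"
proof (rule measurableI)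
  fix B :: "real set" assume "B \<in> sets borel"
  \<comment> \<open>Up to a null set a preimage is everything or nothing, according to whether
    \<open>B\<close> contains 0; the completion makes such a set measurable.\<close>
  let ?A = "if 0 \<in> B then space M else {}"
  show "f -` B \<inter> space (completion M) \<in> sets (completion M)"
  proof (rule completion.in_sets_AE)
    show "?A \<in> sets (completion M)" by auto
    show "AE x in completion M. (x \<in> ?A) = (x \<in> f -` B \<inter> space (completion M))"
      using AE_completion[OF assms] AE_space[of "completion M"] by eventually_elim auto
  qed auto
qed auto

lemma square_integrable_completion_AE_0:
  fixes f :: "'a \<Rightarrow> real"
  assumes "AE x in M. f x = 0"
  shows "f \<in> square_integrable (completion M)"
proof -
  have m: "f \<in> borel_measurable (completion M)"
    by (rule measurable_completion_AE_0[OF assms])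
  have "integrable (completion M) (\<lambda>x. (f x)\<^sup>2) \<longleftrightarrow> integrable (completion M) (\<lambda>x. 0 :: real)"
    using m AE_completion[OF assms] by (intro integrable_cong_AE) (auto elim: eventually_mono)
  with m show ?thesis
    by (simp add: square_integrable_def)
qed

lemma AE_total_var:
  assumes s: "sets \<mu>p = sets \<mu>m" and p: "AE x in \<mu>p. P x" and m: "AE x in \<mu>m. P x"
  shows "AE x in total_var \<mu>p \<mu>m. P x"
proof -
  obtain N where N: "{x \<in> space \<mu>p. \<not> P x} \<subseteq> N" "emeasure \<mu>p N = 0" "N \<in> sets \<mu>p"
    using p by (rule AE_E)
  obtain N' where N': "{x \<in> space \<mu>m. \<not> P x} \<subseteq> N'" "emeasure \<mu>m N' = 0" "N' \<in> sets \<mu>m"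
    using m by (rule AE_E)
  have sp: "space \<mu>p = space \<mu>m"
    by (rule sets_eq_imp_space_eq[OF s])
  have sets: "sets (total_var \<mu>p \<mu>m) = sets \<mu>p"
    by (simp add: total_var_def)
  have spt: "space (total_var \<mu>p \<mu>m) = space \<mu>p"
    by (simp add: total_var_def)
  \<comment> \<open>Each cover is known to be null for one of the measures only. The intersection is
    null for both and still contains the exceptional set, as the two spaces coincide.\<close>
  have I: "N \<inter> N' \<in> sets \<mu>p" "N \<inter> N' \<in> sets \<mu>m"
    using N(3) N'(3) s by auto
  have 0: "emeasure \<mu>p (N \<inter> N') = 0" "emeasure \<mu>m (N \<inter> N') = 0"
    using emeasure_mono[of "N \<inter> N'" N \<mu>p] emeasure_mono[of "N \<inter> N'" N' \<mu>m] N N' by auto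
  have "emeasure (total_var \<mu>p \<mu>m) (N \<inter> N') = 0"
    \<comment> \<open>\<open>measure_of\<close> returns either the prescribed sum or the default
      value 0; both are 0 on this set.\<close>
    unfolding total_var_def using 0 I sets.space_closed[of \<mu>p]
    by (subst emeasure_measure_of_conv) (auto simp: sets.sigma_sets_eq)
  then have "N \<inter> N' \<in> null_sets (total_var \<mu>p \<mu>m)"
    using I sets by auto
  then show ?thesis
    by (rule AE_I') (use N(1) N'(1) sp spt in auto)
qed

lemma qc_rep_test_fun:
  assumes o: "open \<Omega>" and phi: "\<phi> \<in> test_funs \<Omega>" and mu: "smooth_measure \<Omega> \<mu>"
  shows "AE x in \<mu>. qc_rep \<Omega> \<phi> x = 0"
proof -
  have cont: "continuous_on (closure \<Omega>) \<phi>"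
    using test_funs_Cc_closure[OF phi] by (simp add: Cc_closure_def)
  have "quasi_continuous \<Omega> \<phi>"
    unfolding quasi_continuous_def
    using cont rel_cap_empty[OF o] by (auto intro!: exI[of _ "{}"])
  \<comment> \<open>\<phi> itself, with empty exceptional set, witnesses that the choice in
    \<open>qc_rep\<close> succeeds.\<close>
  then have "quasi_continuous \<Omega> \<phi> \<and> (AE x in lebesgue_on \<Omega>. \<phi> x = \<phi> x)"
    by simp
  then have "quasi_continuous \<Omega> (qc_rep \<Omega> \<phi>) \<and> (AE x in lebesgue_on \<Omega>. qc_rep \<Omega> \<phi> x = \<phi> x)"
    unfolding qc_rep_def
    by (rule someI[of "\<lambda>f. quasi_continuous \<Omega> f \<and> (AE x in lebesgue_on \<Omega>. f x = \<phi> x)"])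
  then have "rel_cap \<Omega> {x \<in> closure \<Omega>. qc_rep \<Omega> \<phi> x \<noteq> \<phi> x} = 0"
    using cont by (intro rel_cap_AE_eq_continuous) auto
  from smooth_measure_AE[OF mu this] AE_space[of \<mu>] show ?thesis
  proof eventually_elim
    case (elim x)
    have "x \<in> frontier \<Omega>"
      using elim(2) space_smooth_measure[OF mu] by simp
    then have "x \<in> closure \<Omega>" "x \<notin> \<Omega>"
      using o by (auto simp: frontier_def interior_open)
    with elim(1) test_funs_eq_0[OF phi] show ?case by auto
  qed
qed

theorem mainTheorem4:
  fixes \<Omega> :: "'a::euclidean_space set"
    and X :: "('w, 'a) markov_process"
    and \<mu>p \<mu>m :: "'a measure"
  assumes "open \<Omega>"
    and "associated_diffusion \<Omega> X"
    and "smooth_minus_kato \<Omega> X \<mu>p \<mu>m"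
  shows "\<forall>(u, w) \<in> Delta_mu \<Omega> \<mu>p \<mu>m. u \<in> L2 \<Omega> \<and> w \<in> L2 \<Omega> \<and>
           distr_eq \<Omega> (regular_distr \<Omega> w) (distr_laplacian (regular_distr \<Omega> u))"
proof -
  have smooth: "smooth_measure \<Omega> \<mu>p" "smooth_measure \<Omega> \<mu>m"
    using assms(3) by (auto simp: smooth_minus_kato_def kato_class_def)
  then have sets: "sets \<mu>p = sets \<mu>m"
    by (simp add: smooth_measure_def boundary_measure_def)
  have dom: "\<phi> \<in> form_dom \<Omega> \<mu>p \<mu>m" if "\<phi> \<in> test_funs \<Omega>" for \<phi>
    unfolding form_dom_def
    using test_funs_H1_tilde[OF assms(1) that] smooth
    by (intro CollectI conjI square_integrable_completion_AE_0 AE_total_var[OF sets]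
        qc_rep_test_fun[OF assms(1) that, of \<mu>p] qc_rep_test_fun[OF assms(1) that, of \<mu>m])
  have form: "form_mu \<Omega> \<mu>p \<mu>m u \<phi> = dirichlet \<Omega> u \<phi>" if "\<phi> \<in> test_funs \<Omega>" for u \<phi>
  proof -
    \<comment> \<open>The second factor vanishes almost everywhere, hence so does the product,
      whatever the values of \<open>qc_rep \<Omega> u\<close>.\<close>
    have "(LINT x|completion \<mu>. qc_rep \<Omega> u x * qc_rep \<Omega> \<phi> x) = 0" if "smooth_measure \<Omega> \<mu>" for \<mu>
      using AE_completion[OF qc_rep_test_fun[OF assms(1) \<open>\<phi> \<in> test_funs \<Omega>\<close> that]]
      by (intro integral_eq_zero_AE) (auto elim: eventually_mono)
    with smooth show ?thesis by (simp add: form_mu_def)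
  qed
  show ?thesis
  proof (clarify, unfold Delta_mu_def, clarify)
    fix u v
    assume u: "u \<in> form_dom \<Omega> \<mu>p \<mu>m" and v: "v \<in> L2 \<Omega>"
      and eq: "\<forall>\<phi>\<in>form_dom \<Omega> \<mu>p \<mu>m. form_mu \<Omega> \<mu>p \<mu>m u \<phi> = L2_inner \<Omega> v \<phi>"
    have H1: "u \<in> H1 \<Omega>"
      using u by (simp add: form_dom_def H1_tilde_def)
    then have "u \<in> L2 \<Omega>"
      by (simp add: H1_def)
    moreover have "(\<lambda>x. - v x) \<in> L2 \<Omega>"
      using v by (simp add: square_integrable_def)
    moreover have "regular_distr \<Omega> (\<lambda>x. - v x) \<phi> = distr_laplacian (regular_distr \<Omega> u) \<phi>"
      if phi: "\<phi> \<in> test_funs \<Omega>" for \<phi>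
    proof -
      \<comment> \<open>The graph pairs \<open>u\<close> with the negative of \<open>v\<close>,
        which absorbs the minus sign of \<open>dirichlet_test_fun\<close>.\<close>
      have "L2_inner \<Omega> v \<phi> = dirichlet \<Omega> u \<phi>"
        using bspec[OF eq dom[OF phi]] form[OF phi, of u] by simp
      also have "\<dots> = - distr_laplacian (regular_distr \<Omega> u) \<phi>"
        by (rule dirichlet_test_fun[OF assms(1) H1 phi])
      finally show ?thesis
        by (simp add: regular_distr_def L2_inner_def)
    qed
    ultimately show "u \<in> L2 \<Omega> \<and> (\<lambda>x. - v x) \<in> L2 \<Omega> \<and>
        distr_eq \<Omega> (regular_distr \<Omega> (\<lambda>x. - v x)) (distr_laplacian (regular_distr \<Omega> u))"
      by (simp add: distr_eq_def)
  qed
qed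

end
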